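(* Let $A,B$ be two algebras and $R:B\otimes A\to A\otimes B$ a twisting map, with notation $R(b\otimes a)=a_R\otimes b_R$. Let $\mu:B\otimes A\to A$, $\mu(b\otimes a)=b\cdot a$, and $\rho:A\to A\otimes B$, $\rho(a)=a_{(0)}\otimes a_{(1)}$, be linear maps, and put $a*a':=a_{(0)}(a_{(1)}\cdot a')$ for $a,a'\in A$. Assume $\rho(1)=1\otimes1$, $1\cdot a=a$, $a_{(0)}(a_{(1)}\cdot1)=a$ for all $a\in A$, and $$b\cdot(a*a')=a_{(0)_R}(b_Ra_{(1)}\cdot a'),\qquad \rho(a*a')=a_{(0)}a'_{(0)_R}\otimes a_{(1)_R}a'_{(1)}$$ for all $a,a'\in A$, $b\in B$. Let $A^d$ denote the associative unital algebra $(A,*,1)$. Assume also that we are given a linear map $\lambda:A\to A\otimes B$, $\lambda(a)=a_{[0]}\otimes a_{[1]}$, such that $\lambda(1)=1\otimes1$ and, for all $a,a'\in A$, $$\lambda(aa')=a_{[0]}*(a'_R)_{[0]}\otimes(a'_R)_{[1]}(a_{[1]})_R,$$ $$a_{(0)_{[0]}}\otimes a_{(0)_{[1]}}a_{(1)}=a\otimes1,\qquad a_{[0]_{(0)}}\otimes a_{[0]_{(1)}}a_{[1]}=a\otimes1.$$ Define $$R^d:B\otimes A^d\to A^d\otimes B,\qquad R^d(b\otimes a)=(a_{(0)_R})_{[0]}\otimes(a_{(0)_R})_{[1]}b_Ra_{(1)}.$$ Then $R^d$ is a twisting map and there is an algebra isomorphism $$A^d\otimes_{R^d}B\simeq A\otimes_RB,\qquad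 a\otimes b\mapsto a_{(0)}\otimes a_{(1)}b.$$
   Context: Fix a field or commutative ring $k$; $\otimes=\otimes_k$; algebras are associative unital $k$-algebras, linear means $k$-linear; $\mu_A$ denotes the product of $A$. An object also denotes its identity map. A twisting map for algebras $A,B$ is a linear map $R:B\otimes A\to A\otimes B$ with $$R\circ(B\otimes\mu_A)=(\mu_A\otimes B)\circ(A\otimes R)\circ(R\otimes A),\qquad R\circ(\mu_B\otimes A)=(A\otimes\mu_B)\circ(R\otimes B)\circ(B\otimes R).$$ $A\otimes_RB$ denotes $A\otimes B$ with the associative product $(a\otimes b)(a'\otimes b')=aa'_R\otimes b_Rb'$ (unital with unit $1\otimes 1$ when $R$ is unital, i.e. $R(1\otimes a)=a\otimes1$, $R(b\otimes1)=1\otimes b$). Sweedler-type notation (summation understood): in each formula subscripts indicate the components of $R$, $\rho$, $\lambda$ applied, e.g. in $\lambda(aa')$ the pair $a'_R\otimes(a_{[1]})_R$ is $R(a_{[1]}\otimes a')$; in $\rho(a*a')$ the pair $a'_{(0)_R}\otimes a_{(1)_R}$ is $R(a_{(1)}\otimes a'_{(0)})$; in the first condition and in $R^d$ the pair $a_{(0)_R}\otimes b_R$ is $R(b\otimes a_{(0)})$; $b_Ra_{(1)}\cdot a'$ means $(b_Ra_{(1)})\cdot a'$; $a_{(0)_{[0]}}\otimes a_{(0)_{[1]}}\otimes a_{(1)}=(\lambda\otimes B)(\rho(a))$; $a_{[0]_{(0)}}\otimes a_{[0]_{(1)}}\otimes a_{[1]}=(\rho\otimes B)(\lambda(a))$.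 Juxtaposition is the original product of $A$ or $B$. The hypotheses on $\mu,\rho$ guarantee that $(A,*,1)$ is an associative unital algebra. *)

theory Defs
  imports "HOL-Algebra.Algebra"
begin

text \<open>
  Throughout, modules over a commutative ring \<open>K\<close> are records of type \<open>module\<close> from HOL-Algebra, and
  only their carriers are meaningful. The library locale \<open>algebra\<close> is restricted to commutative
  algebras, hence the following variant.
\<close>

locale assoc_algebra = module R M + ring M for R (structure) and M (structure) +
  assumes smult_mult_left:
      "\<lbrakk>r \<in> carrier R; x \<in> carrier M; y \<in> carrier M\<rbrakk> \<Longrightarrow>
        (r \<odot>\<^bsub>M\<^esub> x) \<otimes>\<^bsub>M\<^esub> y = r \<odot>\<^bsub>M\<^esub> (x \<otimes>\<^bsub>M\<^esub> y)"
    and smult_mult_right: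
      "\<lbrakk>r \<in> carrier R; x \<in> carrier M; y \<in> carrier M\<rbrakk> \<Longrightarrow>
        x \<otimes>\<^bsub>M\<^esub> (r \<odot>\<^bsub>M\<^esub> y) = r \<odot>\<^bsub>M\<^esub> (x \<otimes>\<^bsub>M\<^esub> y)"

definition linear_map ::
    "('k, 'p) ring_scheme \<Rightarrow> ('k, 'a) module \<Rightarrow> ('k, 'b) module \<Rightarrow> ('a \<Rightarrow> 'b) \<Rightarrow> bool" where
  "linear_map K M N f \<longleftrightarrow>
     f \<in> carrier M \<rightarrow> carrier N \<and>
     (\<forall>x\<in>carrier M. \<forall>y\<in>carrier M. f (x \<oplus>\<^bsub>M\<^esub> y) = f x \<oplus>\<^bsub>N\<^esub> f y) \<and>
     (\<forall>r\<in>carrier K. \<forall>x\<in>carrier M. f (r \<odot>\<^bsub>M\<^esub> x) = r \<odot>\<^bsub>N\<^esub> f x)"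

text \<open>
  Here \<open>ring_iso\<close> only requires a bijection compatible with the operations and with the distinguished
  elements \<open>one\<close>; it does not require the two records to be unital rings.
\<close>

definition algebra_iso ::
    "('k, 'p) ring_scheme \<Rightarrow> ('k, 'a) module \<Rightarrow> ('k, 'b) module \<Rightarrow> ('a \<Rightarrow> 'b) \<Rightarrow> bool" where
  "algebra_iso K M N f \<longleftrightarrow> f \<in> ring_iso M N \<and> linear_map K M N f"

section \<open>Tensor products of modules\<close>

text \<open>
  The tensor product of \<open>M\<close> and \<open>N\<close> over \<open>K\<close> is the quotient of the free abelian group on
  \<open>carrier M \<times> carrier N\<close> by the subgroup generated by the usual relations. It carries no
  multiplication, so the fields \<open>mult\<close> and \<open>one\<close> of the record are left undefined.
\<close>

definition tensor_gens ::
    "('k, 'p) ring_scheme \<Rightarrow> ('k, 'a) module \<Rightarrow> ('k, 'b) module \<Rightarrow> ('a \<times> 'b \<Rightarrow>\<^sub>0 int) set" where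
  "tensor_gens K M N =
     {frag_of (x \<oplus>\<^bsub>M\<^esub> x', y) - frag_of (x, y) - frag_of (x', y) | x x' y.
        x \<in> carrier M \<and> x' \<in> carrier M \<and> y \<in> carrier N} \<union>
     {frag_of (x, y \<oplus>\<^bsub>N\<^esub> y') - frag_of (x, y) - frag_of (x, y') | x y y'.
        x \<in> carrier M \<and> y \<in> carrier N \<and> y' \<in> carrier N} \<union>
     {frag_of (r \<odot>\<^bsub>M\<^esub> x, y) - frag_of (x, r \<odot>\<^bsub>N\<^esub> y) | r x y.
        r \<in> carrier K \<and> x \<in> carrier M \<and> y \<in> carrier N}"

definition tensor_rels ::
    "('k, 'p) ring_scheme \<Rightarrow> ('k, 'a) module \<Rightarrow> ('k, 'b) module \<Rightarrow> ('a \<times> 'b \<Rightarrow>\<^sub>0 int) set" where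
  "tensor_rels K M N = generate (free_Abelian_group (carrier M \<times> carrier N)) (tensor_gens K M N)"

definition tensor ::
    "('k, 'p) ring_scheme \<Rightarrow> ('k, 'a) module \<Rightarrow> ('k, 'b) module
      \<Rightarrow> ('k, ('a \<times> 'b \<Rightarrow>\<^sub>0 int) set) module" where
  "tensor K M N =
     (let F = free_Abelian_group (carrier M \<times> carrier N); Q = F Mod tensor_rels K M N in
      \<lparr>carrier = carrier Q, monoid.mult = undefined, one = undefined,
       ring.zero = \<one>\<^bsub>Q\<^esub>, ring.add = (\<lambda>s t. s \<otimes>\<^bsub>Q\<^esub> t),
       smult = (\<lambda>r t. \<Union>c\<in>t. tensor_rels K M N #>\<^bsub>F\<^esub>
                  frag_extend (\<lambda>(x, y). frag_of (r \<odot>\<^bsub>M\<^esub> x, y)) c)\<rparr>)"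

definition pure_tensor ::
    "('k, 'p) ring_scheme \<Rightarrow> ('k, 'a) module \<Rightarrow> ('k, 'b) module
      \<Rightarrow> 'a \<Rightarrow> 'b \<Rightarrow> ('a \<times> 'b \<Rightarrow>\<^sub>0 int) set" where
  "pure_tensor K M N x y =
     tensor_rels K M N #>\<^bsub>free_Abelian_group (carrier M \<times> carrier N)\<^esub> frag_of (x, y)"

text \<open>
  Sweedler-type notation: \<open>sweedler P t (\<lambda>x y. f x y)\<close> is the value of the expression \<open>f x y\<close> in \<open>P\<close>,
  where the tensor \<open>t\<close> is written as \<open>x \<otimes> y\<close> (summation understood). In other words it is the value at \<open>t\<close>
  of the linear extension of the \<open>K\<close>-bilinear map \<open>f\<close>: the sum of \<open>f\<close> over a representative of the
  coset \<open>t\<close>, which does not depend on the representative if \<open>f\<close> is bilinear (the only case in which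
  it is used).
\<close>

definition sweedler ::
    "('k, 'c) module \<Rightarrow> ('a \<times> 'b \<Rightarrow>\<^sub>0 int) set \<Rightarrow> ('a \<Rightarrow> 'b \<Rightarrow> 'c) \<Rightarrow> 'c" where
  "sweedler P t f =
     the_elem ((\<lambda>c. \<Oplus>\<^bsub>P\<^esub>p\<in>Poly_Mapping.keys c.
                   add_pow P (Poly_Mapping.lookup c p) (f (fst p) (snd p))) ` t)"

text \<open>The map \<open>f \<otimes> g\<close> into \<open>tensor K M N\<close>, the two associativity isomorphisms, and the product of an
  algebra as a linear map on its tensor square.\<close>

definition tensor_map ::
    "('k, 'p) ring_scheme \<Rightarrow> ('k, 'c) module \<Rightarrow> ('k, 'd) module
      \<Rightarrow> ('a \<Rightarrow> 'c) \<Rightarrow> ('b \<Rightarrow> 'd) \<Rightarrow> ('a \<times> 'b \<Rightarrow>\<^sub>0 int) set \<Rightarrow> ('c \<times> 'd \<Rightarrow>\<^sub>0 int) set" where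
  "tensor_map K M N f g t =
     sweedler (tensor K M N) t (\<lambda>x y. pure_tensor K M N (f x) (g y))"

definition assoc_right ::
    "('k, 'p) ring_scheme \<Rightarrow> ('k, 'a) module \<Rightarrow> ('k, 'b) module \<Rightarrow> ('k, 'c) module
      \<Rightarrow> (('a \<times> 'b \<Rightarrow>\<^sub>0 int) set \<times> 'c \<Rightarrow>\<^sub>0 int) set
      \<Rightarrow> ('a \<times> ('b \<times> 'c \<Rightarrow>\<^sub>0 int) set \<Rightarrow>\<^sub>0 int) set" where
  "assoc_right K L M N t =
     (let T = tensor K L (tensor K M N) in
      sweedler T t (\<lambda>s z. sweedler T s (\<lambda>x y.
        pure_tensor K L (tensor K M N) x (pure_tensor K M N y z))))"

definition assoc_left ::
    "('k, 'p) ring_scheme \<Rightarrow> ('k, 'a) module \<Rightarrow> ('k, 'b) module \<Rightarrow> ('k, 'c) module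
      \<Rightarrow> ('a \<times> ('b \<times> 'c \<Rightarrow>\<^sub>0 int) set \<Rightarrow>\<^sub>0 int) set
      \<Rightarrow> (('a \<times> 'b \<Rightarrow>\<^sub>0 int) set \<times> 'c \<Rightarrow>\<^sub>0 int) set" where
  "assoc_left K L M N t =
     (let T = tensor K (tensor K L M) N in
      sweedler T t (\<lambda>x s. sweedler T s (\<lambda>y z.
        pure_tensor K (tensor K L M) N (pure_tensor K L M x y) z)))"

definition mult_map :: "('k, 'a) module \<Rightarrow> ('a \<times> 'a \<Rightarrow>\<^sub>0 int) set \<Rightarrow> 'a" where
  "mult_map A t = sweedler A t (\<lambda>x y. x \<otimes>\<^bsub>A\<^esub> y)"

section \<open>Twisting maps and twisted tensor products\<close>

text \<open>
  Twisting maps are not assumed to be unital. The two hexagon identities are identities of maps on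
  \<open>B \<otimes> (A \<otimes> A)\<close> and \<open>(B \<otimes> B) \<otimes> A\<close>, with the associativity isomorphisms written out.
\<close>

locale twisting_map = A: assoc_algebra K A + B: assoc_algebra K B
  for K :: "('k, 'p) ring_scheme" and A :: "('k, 'a) module" and B :: "('k, 'b) module" +
  fixes R :: "('b \<times> 'a \<Rightarrow>\<^sub>0 int) set \<Rightarrow> ('a \<times> 'b \<Rightarrow>\<^sub>0 int) set"
  assumes linear: "linear_map K (tensor K B A) (tensor K A B) R"
    and mult_A: "\<And>t. t \<in> carrier (tensor K B (tensor K A A)) \<Longrightarrow>
       R (tensor_map K B A id (mult_map A) t) =
       (tensor_map K A B (mult_map A) id \<circ> assoc_left K A A B
        \<circ> tensor_map K A (tensor K A B) id R \<circ> assoc_right K A B A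
        \<circ> tensor_map K (tensor K A B) A R id \<circ> assoc_left K B A A) t"
    and mult_B: "\<And>t. t \<in> carrier (tensor K (tensor K B B) A) \<Longrightarrow>
       R (tensor_map K B A (mult_map B) id t) =
       (tensor_map K A B id (mult_map B) \<circ> assoc_right K A B B
        \<circ> tensor_map K (tensor K A B) B R id \<circ> assoc_left K B A B
        \<circ> tensor_map K B (tensor K A B) id R \<circ> assoc_right K B B A) t"

text \<open>
  The product of \<open>x \<otimes> y\<close> and \<open>x' \<otimes> y'\<close> is \<open>x x'\<^sub>R \<otimes> y\<^sub>R y'\<close>. The distinguished element \<open>1 \<otimes> 1\<close> is a unit if
  \<open>R\<close> is unital.
\<close>

definition twisted_tensor ::
    "('k, 'p) ring_scheme \<Rightarrow> ('k, 'a) module \<Rightarrow> ('k, 'b) module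
      \<Rightarrow> (('b \<times> 'a \<Rightarrow>\<^sub>0 int) set \<Rightarrow> ('a \<times> 'b \<Rightarrow>\<^sub>0 int) set)
      \<Rightarrow> ('k, ('a \<times> 'b \<Rightarrow>\<^sub>0 int) set) module" where
  "twisted_tensor K A B R =
     (tensor K A B)
       \<lparr>monoid.mult := (\<lambda>s t.
          sweedler (tensor K A B) s (\<lambda>x y.
          sweedler (tensor K A B) t (\<lambda>x' y'.
          sweedler (tensor K A B) (R (pure_tensor K B A y x')) (\<lambda>xR yR.
            pure_tensor K A B (x \<otimes>\<^bsub>A\<^esub> xR) (yR \<otimes>\<^bsub>B\<^esub> y'))))),
        one := pure_tensor K A B \<one>\<^bsub>A\<^esub> \<one>\<^bsub>B\<^esub>\<rparr>"

section \<open>The deformed algebra and the deformed twisting map\<close>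

text \<open>The product \<open>a * a' = a\<^sub>0 (a\<^sub>1 \<cdot> a')\<close>, where \<open>\<rho> a = a\<^sub>0 \<otimes> a\<^sub>1\<close> and \<open>b \<cdot> a = \<mu> (b \<otimes> a)\<close>.\<close>

definition deformed_mult ::
    "('k, 'p) ring_scheme \<Rightarrow> ('k, 'a) module \<Rightarrow> ('k, 'b) module
      \<Rightarrow> (('b \<times> 'a \<Rightarrow>\<^sub>0 int) set \<Rightarrow> 'a) \<Rightarrow> ('a \<Rightarrow> ('a \<times> 'b \<Rightarrow>\<^sub>0 int) set) \<Rightarrow> 'a \<Rightarrow> 'a \<Rightarrow> 'a" where
  "deformed_mult K A B \<mu> \<rho> a a' =
     sweedler A (\<rho> a) (\<lambda>a0 a1. a0 \<otimes>\<^bsub>A\<^esub> \<mu> (pure_tensor K B A a1 a'))"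

definition deformed_algebra ::
    "('k, 'p) ring_scheme \<Rightarrow> ('k, 'a) module \<Rightarrow> ('k, 'b) module
      \<Rightarrow> (('b \<times> 'a \<Rightarrow>\<^sub>0 int) set \<Rightarrow> 'a) \<Rightarrow> ('a \<Rightarrow> ('a \<times> 'b \<Rightarrow>\<^sub>0 int) set) \<Rightarrow> ('k, 'a) module" where
  "deformed_algebra K A B \<mu> \<rho> = A\<lparr>monoid.mult := deformed_mult K A B \<mu> \<rho>\<rparr>"

text \<open>
  The map \<open>R\<^sup>d\<close> only involves the original products of \<open>A\<close> and \<open>B\<close>. The deformed algebra has the same
  underlying module as \<open>A\<close>, so that its tensor products with \<open>B\<close> are those of \<open>A\<close>.
  The variable \<open>\<Lambda>\<close> stands for the map \<open>\<lambda>\<close> of the mathematical notation, and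
  \<open>R\<^sup>d (b \<otimes> a) = c\<^sub>0 \<otimes> c\<^sub>1 b\<^sub>R a\<^sub>1\<close>, where \<open>\<Lambda> a\<^sub>0\<^sub>R = c\<^sub>0 \<otimes> c\<^sub>1\<close>.
\<close>

definition deformed_twisting ::
    "('k, 'p) ring_scheme \<Rightarrow> ('k, 'a) module \<Rightarrow> ('k, 'b) module
      \<Rightarrow> (('b \<times> 'a \<Rightarrow>\<^sub>0 int) set \<Rightarrow> ('a \<times> 'b \<Rightarrow>\<^sub>0 int) set)
      \<Rightarrow> ('a \<Rightarrow> ('a \<times> 'b \<Rightarrow>\<^sub>0 int) set) \<Rightarrow> ('a \<Rightarrow> ('a \<times> 'b \<Rightarrow>\<^sub>0 int) set)
      \<Rightarrow> ('b \<times> 'a \<Rightarrow>\<^sub>0 int) set \<Rightarrow> ('a \<times> 'b \<Rightarrow>\<^sub>0 int) set" where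
  "deformed_twisting K A B R \<rho> \<Lambda> t =
     sweedler (tensor K A B) t (\<lambda>b a.
     sweedler (tensor K A B) (\<rho> a) (\<lambda>a0 a1.
     sweedler (tensor K A B) (R (pure_tensor K B A b a0)) (\<lambda>a0R bR.
     sweedler (tensor K A B) (\<Lambda> a0R) (\<lambda>c0 c1.
       pure_tensor K A B c0 (c1 \<otimes>\<^bsub>B\<^esub> bR \<otimes>\<^bsub>B\<^esub> a1)))))"

text \<open>The map \<open>a \<otimes> b \<mapsto> a\<^sub>0 \<otimes> a\<^sub>1 b\<close>.\<close>

definition deformation_map ::
    "('k, 'p) ring_scheme \<Rightarrow> ('k, 'a) module \<Rightarrow> ('k, 'b) module
      \<Rightarrow> ('a \<Rightarrow> ('a \<times> 'b \<Rightarrow>\<^sub>0 int) set)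
      \<Rightarrow> ('a \<times> 'b \<Rightarrow>\<^sub>0 int) set \<Rightarrow> ('a \<times> 'b \<Rightarrow>\<^sub>0 int) set" where
  "deformation_map K A B \<rho> t =
     sweedler (tensor K A B) t (\<lambda>a b.
     sweedler (tensor K A B) (\<rho> a) (\<lambda>a0 a1.
       pure_tensor K A B a0 (a1 \<otimes>\<^bsub>B\<^esub> b)))"

end

theory Submission
  imports Defs
begin

text \<open>
  Write \<open>T = A \<otimes> B\<close>, a right \<open>B\<close>-module, and let \<open>B\<close> act on \<open>T\<close> from the left by
  \<open>b \<triangleright> (x \<otimes> y) = R (b \<otimes> x) y\<close>. The hexagon identities say that this is an action and that
  \<open>b \<triangleright> (s t) = (b \<triangleright> s) t\<close> for the twisted product \<open>(x \<otimes> y) t = x (y \<triangleright> t)\<close>. The hypotheses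
  relating \<open>\<rho>\<close> and \<open>\<Lambda>\<close> say that the right \<open>B\<close>-linear maps \<open>\<phi> (a \<otimes> b) = \<rho> a b\<close> and
  \<open>\<psi> (a \<otimes> b) = \<Lambda> a b\<close> are inverse to each other, the condition on \<open>\<rho> (a * a')\<close> says
  \<open>\<rho> (a * a') = \<rho> a \<rho> a'\<close>, and \<open>R\<^sup>d (b \<otimes> a) = \<psi> (b \<triangleright> \<rho> a)\<close>, that is,
  \<open>\<phi> (R\<^sup>d (b \<otimes> a)) = b \<triangleright> \<rho> a\<close>. Hence \<open>\<phi>\<close> turns the action and the product built from \<open>R\<^sup>d\<close>
  into those built from \<open>R\<close>; as \<open>\<phi>\<close> is injective, the hexagon identities for \<open>R\<^sup>d\<close> follow from
  those for \<open>R\<close>, and \<open>\<phi>\<close> is the required isomorphism.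
\<close>

section \<open>The universal property of the tensor product\<close>

text \<open>The function inside \<open>sweedler\<close>, isolated as a map on formal sums:
  \<open>sweedler P t f\<close> is \<open>the_elem\<close> of its image of the coset
  \<open>t\<close>. Well-definedness of Sweedler expressions thus amounts to this map being constant
  on cosets.\<close>

definition frag_eval :: "('c, 'm) ring_scheme \<Rightarrow> ('s \<Rightarrow> 'c) \<Rightarrow> ('s \<Rightarrow>\<^sub>0 int) \<Rightarrow> 'c" where
  "frag_eval P f c =
     (\<Oplus>\<^bsub>P\<^esub>p\<in>Poly_Mapping.keys c. add_pow P (Poly_Mapping.lookup c p) (f p))"

lemma add_pow_zero_int: "add_pow G (0::int) x = \<zero>\<^bsub>G\<^esub>"
  by (simp add: add_pow_def)

text \<open>Points outside the support have coefficient 0 and contribute zero, so sums over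
  different supports can be compared over one common index set.\<close>

lemma (in abelian_group) frag_eval_superset:
  assumes "f \<in> S \<rightarrow> carrier G" "finite U" "Poly_Mapping.keys c \<subseteq> U" "U \<subseteq> S"
  shows "frag_eval G f c = (\<Oplus>p\<in>U. add_pow G (Poly_Mapping.lookup c p) (f p))"
  unfolding frag_eval_def
  by (rule add.finprod_mono_neutral_cong_left)
     (use assms in \<open>auto simp: in_keys_iff add_pow_zero_int intro!: add.int_pow_closed\<close>)

lemma (in abelian_group) frag_eval_hom:
  assumes f: "f \<in> S \<rightarrow> carrier G"
  shows "frag_eval G f \<in> hom (free_Abelian_group S) (add_monoid G)"
proof (rule homI)
  fix c assume "c \<in> carrier (free_Abelian_group S)"
  then show "frag_eval G f c \<in> carrier (add_monoid G)"
    unfolding frag_eval_def using f by (auto intro!: finsum_closed add.int_pow_closed)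
next
  fix c d assume cd: "c \<in> carrier (free_Abelian_group S)" "d \<in> carrier (free_Abelian_group S)"
  \<comment> \<open>Cancellation may make the support of \<open>c + d\<close> smaller than this
    union; all three sums are therefore taken over \<open>U\<close>.\<close>
  define U where "U = Poly_Mapping.keys c \<union> Poly_Mapping.keys d"
  have U: "finite U" "U \<subseteq> S" "Poly_Mapping.keys c \<subseteq> U" "Poly_Mapping.keys d \<subseteq> U"
    "Poly_Mapping.keys (c + d) \<subseteq> U"
    using cd keys_add[of c d] by (auto simp: U_def)
  have fU: "f p \<in> carrier G" if "p \<in> U" for p using f U that by auto
  have "(\<Oplus>p\<in>U. add_pow G (Poly_Mapping.lookup (c + d) p) (f p)) =
      (\<Oplus>p\<in>U. add_pow G (Poly_Mapping.lookup c p) (f p) \<oplus> add_pow G (Poly_Mapping.lookup d p) (f p))"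
    by (rule add.finprod_cong')
       (use fU in \<open>auto simp: lookup_add add.int_pow_mult intro!: add.int_pow_closed\<close>)
  also have "\<dots> = (\<Oplus>p\<in>U. add_pow G (Poly_Mapping.lookup c p) (f p)) \<oplus>
                 (\<Oplus>p\<in>U. add_pow G (Poly_Mapping.lookup d p) (f p))"
    by (rule finsum_addf) (use f U in \<open>auto intro!: add.int_pow_closed\<close>)
  finally show "frag_eval G f (c \<otimes>\<^bsub>free_Abelian_group S\<^esub> d) =
      frag_eval G f c \<otimes>\<^bsub>add_monoid G\<^esub> frag_eval G f d"
    using U by (simp add: frag_eval_superset[OF f U(1)])
qed

lemma (in abelian_group) frag_eval_of:
  assumes "f x \<in> carrier G"
  shows "frag_eval G f (frag_of x) = f x"
  using assms by (simp add: frag_eval_def add.finprod_singleton)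

text \<open>The kernel is a subgroup containing \<open>S\<close>, hence contains the subgroup
  generated by \<open>S\<close>. This reduces statements about all tensor relations to the three
  kinds of generators.\<close>

lemma group_hom_vanish_generate:
  assumes h: "h \<in> hom G H" and G: "group G" and H: "group H"
    and S: "S \<subseteq> carrier G" "\<And>x. x \<in> S \<Longrightarrow> h x = \<one>\<^bsub>H\<^esub>" and x: "x \<in> generate G S"
  shows "h x = \<one>\<^bsub>H\<^esub>"
proof -
  interpret group_hom G H h
    using h G H by (simp add: group_hom_def group_hom_axioms_def)
  have "S \<subseteq> kernel G H h" using S by (auto simp: kernel_def)
  then have "generate G S \<subseteq> kernel G H h"
    by (rule G.generate_subgroup_incl) (rule subgroup_kernel)
  with x show ?thesis by (auto simp: kernel_def)
qed

section \<open>Linear and bilinear maps between modules\<close>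

definition bilinear_map ::
    "('k, 'p) ring_scheme \<Rightarrow> ('k, 'a) module \<Rightarrow> ('k, 'b) module \<Rightarrow> ('k, 'c) module
      \<Rightarrow> ('a \<Rightarrow> 'b \<Rightarrow> 'c) \<Rightarrow> bool" where
  "bilinear_map K M N P f \<longleftrightarrow>
     (\<forall>x\<in>carrier M. linear_map K N P (f x)) \<and>
     (\<forall>y\<in>carrier N. linear_map K M P (\<lambda>x. f x y))"

lemma linear_mapD:
  assumes "linear_map K M N f"
  shows "x \<in> carrier M \<Longrightarrow> f x \<in> carrier N"
    and "x \<in> carrier M \<Longrightarrow> y \<in> carrier M \<Longrightarrow> f (x \<oplus>\<^bsub>M\<^esub> y) = f x \<oplus>\<^bsub>N\<^esub> f y"
    and "r \<in> carrier K \<Longrightarrow> x \<in> carrier M \<Longrightarrow> f (r \<odot>\<^bsub>M\<^esub> x) = r \<odot>\<^bsub>N\<^esub> f x"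
  using assms by (auto simp: linear_map_def)

lemma linear_mapI:
  assumes "\<And>x. x \<in> carrier M \<Longrightarrow> f x \<in> carrier N"
    and "\<And>x y. x \<in> carrier M \<Longrightarrow> y \<in> carrier M \<Longrightarrow> f (x \<oplus>\<^bsub>M\<^esub> y) = f x \<oplus>\<^bsub>N\<^esub> f y"
    and "\<And>r x. r \<in> carrier K \<Longrightarrow> x \<in> carrier M \<Longrightarrow> f (r \<odot>\<^bsub>M\<^esub> x) = r \<odot>\<^bsub>N\<^esub> f x"
  shows "linear_map K M N f"
  using assms by (auto simp: linear_map_def)

lemma bilinear_mapD:
  assumes "bilinear_map K M N P f"
  shows "x \<in> carrier M \<Longrightarrow> linear_map K N P (f x)"
    and "y \<in> carrier N \<Longrightarrow> linear_map K M P (\<lambda>x. f x y)"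
  using assms by (auto simp: bilinear_map_def)

lemma bilinear_map_closed:
  assumes "bilinear_map K M N P f" "x \<in> carrier M" "y \<in> carrier N"
  shows "f x y \<in> carrier P"
  using bilinear_mapD(1)[OF assms(1,2)] assms(3) by (rule linear_mapD(1))

lemma bilinear_mapI:
  assumes "\<And>x. x \<in> carrier M \<Longrightarrow> linear_map K N P (\<lambda>y. f x y)"
    and "\<And>y. y \<in> carrier N \<Longrightarrow> linear_map K M P (\<lambda>x. f x y)"
  shows "bilinear_map K M N P f"
  using assms by (auto simp: bilinear_map_def)

section \<open>The tensor product of two modules as a quotient of a free abelian group\<close>

locale two_modules = M: module K M + N: module K N
  for K :: "('k, 'p) ring_scheme" and M :: "('k, 'a) module" and N :: "('k, 'b) module"
begin

abbreviation "F \<equiv> free_Abelian_group (carrier M \<times> carrier N)"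
abbreviation "rels \<equiv> tensor_rels K M N"
abbreviation "T \<equiv> tensor K M N"
abbreviation pure_T (infixl \<open>\<otimes>\<^sub>T\<close> 70) where "x \<otimes>\<^sub>T y \<equiv> pure_tensor K M N x y"

lemma tensor_gensI:
  shows "x \<in> carrier M \<Longrightarrow> x' \<in> carrier M \<Longrightarrow> y \<in> carrier N \<Longrightarrow>
      frag_of (x \<oplus>\<^bsub>M\<^esub> x', y) - frag_of (x, y) - frag_of (x', y) \<in> tensor_gens K M N"
    and "x \<in> carrier M \<Longrightarrow> y \<in> carrier N \<Longrightarrow> y' \<in> carrier N \<Longrightarrow>
      frag_of (x, y \<oplus>\<^bsub>N\<^esub> y') - frag_of (x, y) - frag_of (x, y') \<in> tensor_gens K M N"
    and "r \<in> carrier K \<Longrightarrow> x \<in> carrier M \<Longrightarrow> y \<in> carrier N \<Longrightarrow>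
      frag_of (r \<odot>\<^bsub>M\<^esub> x, y) - frag_of (x, r \<odot>\<^bsub>N\<^esub> y) \<in> tensor_gens K M N"
  unfolding tensor_gens_def by blast+

lemma tensor_gens_cases [consumes 1]:
  assumes "c \<in> tensor_gens K M N"
  obtains x x' y where "x \<in> carrier M" "x' \<in> carrier M" "y \<in> carrier N"
      "c = frag_of (x \<oplus>\<^bsub>M\<^esub> x', y) - frag_of (x, y) - frag_of (x', y)"
    | x y y' where "x \<in> carrier M" "y \<in> carrier N" "y' \<in> carrier N"
      "c = frag_of (x, y \<oplus>\<^bsub>N\<^esub> y') - frag_of (x, y) - frag_of (x, y')"
    | r x y where "r \<in> carrier K" "x \<in> carrier M" "y \<in> carrier N"
      "c = frag_of (r \<odot>\<^bsub>M\<^esub> x, y) - frag_of (x, r \<odot>\<^bsub>N\<^esub> y)"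
  using assms unfolding tensor_gens_def
  by (elim UnE CollectE exE conjE) ((rule that, assumption+)[1])+

lemma tensor_gens_carrier: "tensor_gens K M N \<subseteq> carrier F"
proof
  fix c assume "c \<in> tensor_gens K M N"
  then show "c \<in> carrier F"
  proof (cases rule: tensor_gens_cases)
    case (1 x x' y)
    then show ?thesis using keys_diff[of "frag_of (x \<oplus>\<^bsub>M\<^esub> x', y) - frag_of (x, y)" "frag_of (x', y)"]
      keys_diff[of "frag_of (x \<oplus>\<^bsub>M\<^esub> x', y)" "frag_of (x, y)"] by auto
  next
    case (2 x y y')
    then show ?thesis using keys_diff[of "frag_of (x, y \<oplus>\<^bsub>N\<^esub> y') - frag_of (x, y)" "frag_of (x, y')"]
      keys_diff[of "frag_of (x, y \<oplus>\<^bsub>N\<^esub> y')" "frag_of (x, y)"] by auto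
  next
    case (3 r x y)
    then show ?thesis using keys_diff[of "frag_of (r \<odot>\<^bsub>M\<^esub> x, y)" "frag_of (x, r \<odot>\<^bsub>N\<^esub> y)"] by auto
  qed
qed

sublocale F: comm_group F by (rule abelian_free_Abelian_group)

lemma rels_subgroup: "subgroup rels F"
  unfolding tensor_rels_def by (rule F.generate_is_subgroup[OF tensor_gens_carrier])

sublocale rels: normal rels F
  by (rule F.subgroup_imp_normal[OF rels_subgroup])

text \<open>The operation of \<open>F\<close> is addition of finitely supported functions, so
  equality of cosets becomes membership of a difference in \<open>rels\<close>. The relations
  between pure tensors are read off from the generators in this way.\<close>

lemma coset_eq_iff:
  assumes "c \<in> carrier F" "d \<in> carrier F"
  shows "rels #>\<^bsub>F\<^esub> c = rels #>\<^bsub>F\<^esub> d \<longleftrightarrow> c - d \<in> rels"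
proof
  assume "rels #>\<^bsub>F\<^esub> c = rels #>\<^bsub>F\<^esub> d"
  then have "c \<in> rels #>\<^bsub>F\<^esub> d" using F.rcos_self[OF assms(1) rels_subgroup] by simp
  then obtain e where "e \<in> rels" "c = e + d"
    unfolding r_coset_def mult_free_Abelian_group by blast
  then show "c - d \<in> rels" by simp
next
  assume "c - d \<in> rels"
  then have "c - d + d \<in> rels #>\<^bsub>F\<^esub> d" unfolding r_coset_def mult_free_Abelian_group by blast
  then show "rels #>\<^bsub>F\<^esub> c = rels #>\<^bsub>F\<^esub> d"
    using F.repr_independence[OF _ assms(2) rels_subgroup] by simp
qed

lemma carrier_tensor: "carrier T = (\<lambda>c. rels #>\<^bsub>F\<^esub> c) ` carrier F"
  by (simp add: tensor_def Let_def carrier_FactGroup)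

lemma zero_tensor: "\<zero>\<^bsub>T\<^esub> = rels #>\<^bsub>F\<^esub> 0"
  using F.coset_mult_one[OF rels.subset] by (simp add: tensor_def Let_def)

lemma add_tensor:
  assumes "c \<in> carrier F" "d \<in> carrier F"
  shows "(rels #>\<^bsub>F\<^esub> c) \<oplus>\<^bsub>T\<^esub> (rels #>\<^bsub>F\<^esub> d) = rels #>\<^bsub>F\<^esub> (c + d)"
  using rels.rcos_sum[OF assms] by (simp add: tensor_def Let_def)

lemma abelian_group_tensor: "abelian_group T"
proof (rule abelian_groupI)
  fix x assume "x \<in> carrier T"
  then obtain c where c: "c \<in> carrier F" "x = rels #>\<^bsub>F\<^esub> c" by (auto simp: carrier_tensor)
  have c': "-c \<in> carrier F" using c by simp
  have "(rels #>\<^bsub>F\<^esub> (-c)) \<oplus>\<^bsub>T\<^esub> x = \<zero>\<^bsub>T\<^esub>"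
    unfolding c(2) add_tensor[OF c' c(1)] by (simp add: zero_tensor)
  moreover have "rels #>\<^bsub>F\<^esub> (-c) \<in> carrier T" using c' by (auto simp: carrier_tensor)
  ultimately
  show "\<exists>y\<in>carrier T. y \<oplus>\<^bsub>T\<^esub> x = \<zero>\<^bsub>T\<^esub>" by blast
qed (use F.m_closed in \<open>auto simp: carrier_tensor zero_tensor add_tensor ac_simps intro!: imageI\<close>)

sublocale T: abelian_group T by (rule abelian_group_tensor)

lemma frag_of_F: "x \<in> carrier M \<Longrightarrow> y \<in> carrier N \<Longrightarrow> frag_of (x, y) \<in> carrier F"
  by simp

lemma pure_closed [simp]: "x \<in> carrier M \<Longrightarrow> y \<in> carrier N \<Longrightarrow> x \<otimes>\<^sub>T y \<in> carrier T"
  by (auto simp: pure_tensor_def carrier_tensor)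

lemma gen_in_rels: "c \<in> tensor_gens K M N \<Longrightarrow> c \<in> rels"
  unfolding tensor_rels_def by (rule generate.incl)

lemma pure_add_left:
  assumes "x \<in> carrier M" "x' \<in> carrier M" "y \<in> carrier N"
  shows "(x \<oplus>\<^bsub>M\<^esub> x') \<otimes>\<^sub>T y = x \<otimes>\<^sub>T y \<oplus>\<^bsub>T\<^esub> x' \<otimes>\<^sub>T y"
proof -
  have "frag_of (x \<oplus>\<^bsub>M\<^esub> x', y) - (frag_of (x, y) + frag_of (x', y)) \<in> rels"
    by (rule gen_in_rels) (use assms in \<open>auto simp: tensor_gens_def diff_diff_eq\<close>)
  then show ?thesis using assms F.m_closed[OF frag_of_F frag_of_F, of x y x' y]
    by (simp add: pure_tensor_def add_tensor coset_eq_iff)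
qed

lemma pure_add_right:
  assumes "x \<in> carrier M" "y \<in> carrier N" "y' \<in> carrier N"
  shows "x \<otimes>\<^sub>T (y \<oplus>\<^bsub>N\<^esub> y') = x \<otimes>\<^sub>T y \<oplus>\<^bsub>T\<^esub> x \<otimes>\<^sub>T y'"
proof -
  have "frag_of (x, y \<oplus>\<^bsub>N\<^esub> y') - (frag_of (x, y) + frag_of (x, y')) \<in> rels"
    by (rule gen_in_rels) (use assms in \<open>auto simp: tensor_gens_def diff_diff_eq\<close>)
  then show ?thesis using assms F.m_closed[OF frag_of_F frag_of_F, of x y x y']
    by (simp add: pure_tensor_def add_tensor coset_eq_iff)
qed

lemma pure_smult_swap:
  assumes "r \<in> carrier K" "x \<in> carrier M" "y \<in> carrier N"
  shows "(r \<odot>\<^bsub>M\<^esub> x) \<otimes>\<^sub>T y = x \<otimes>\<^sub>T (r \<odot>\<^bsub>N\<^esub> y)"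
proof -
  have "frag_of (r \<odot>\<^bsub>M\<^esub> x, y) - frag_of (x, r \<odot>\<^bsub>N\<^esub> y) \<in> rels"
    by (rule gen_in_rels) (use assms in \<open>auto simp: tensor_gens_def\<close>)
  then show ?thesis using assms
    by (simp add: pure_tensor_def coset_eq_iff)
qed

text \<open>Every element is an integer combination of pure tensors, and the negative of a pure
  tensor is pure: -(x \<otimes> y) = (-x) \<otimes> y. Hence sums of pure tensors already exhaust
  \<open>T\<close>, and no clause for zero, negatives or scalars has to be stated.\<close>

lemma tensor_induct [consumes 1, case_names pure add]:
  assumes t: "t \<in> carrier T"
    and pure: "\<And>x y. x \<in> carrier M \<Longrightarrow> y \<in> carrier N \<Longrightarrow> Q (x \<otimes>\<^sub>T y)"
    and add: "\<And>s t. s \<in> carrier T \<Longrightarrow> t \<in> carrier T \<Longrightarrow> Q s \<Longrightarrow> Q t \<Longrightarrow> Q (s \<oplus>\<^bsub>T\<^esub> t)"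
  shows "Q t"
proof -
  obtain c where c: "c \<in> carrier F" "t = rels #>\<^bsub>F\<^esub> c" using t by (auto simp: carrier_tensor)
  have pure_zero: "\<zero>\<^bsub>M\<^esub> \<otimes>\<^sub>T y = \<zero>\<^bsub>T\<^esub>" if "y \<in> carrier N" for y
    using pure_add_left[of "\<zero>\<^bsub>M\<^esub>" "\<zero>\<^bsub>M\<^esub>" y] that by (simp add: T.add.l_cancel_one')
  have minus_zero: "\<ominus>\<^bsub>T\<^esub> \<zero>\<^bsub>T\<^esub> = \<zero>\<^bsub>T\<^esub>"
    by (rule T.minus_equality) auto
  have minus: "\<ominus>\<^bsub>T\<^esub> (x \<otimes>\<^sub>T y) = (\<ominus>\<^bsub>M\<^esub> x) \<otimes>\<^sub>T y" if "x \<in> carrier M" "y \<in> carrier N" for x y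
    using pure_add_left[of "\<ominus>\<^bsub>M\<^esub> x" x y] that pure_zero[of y]
    by (simp add: M.l_neg T.minus_equality)
  \<comment> \<open>Induction on the free abelian group proceeds by differences, whereas
    \<open>Q\<close> is only known to be stable under sums; the claim is therefore proved for an
    element together with its negative.\<close>
  have "Q (rels #>\<^bsub>F\<^esub> c) \<and> Q (\<ominus>\<^bsub>T\<^esub> (rels #>\<^bsub>F\<^esub> c))"
    using c(1)[unfolded carrier_free_Abelian_group_iff]
  proof (induction rule: free_Abelian_group_induct[consumes 1, case_names zero diff frag_of])
    case zero
    then show ?case using pure[OF M.zero_closed N.zero_closed]

      by (simp add: pure_zero minus_zero flip: zero_tensor)
  next
    case (diff c d)
    then have cd: "c \<in> carrier F" "-d \<in> carrier F" "d \<in> carrier F" "-c \<in> carrier F" by auto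
    have m: "\<ominus>\<^bsub>T\<^esub> (rels #>\<^bsub>F\<^esub> e) = rels #>\<^bsub>F\<^esub> (-e)" if "e \<in> carrier F" "-e \<in> carrier F" for e
      by (rule T.minus_equality) (use that in \<open>auto simp: carrier_tensor add_tensor zero_tensor\<close>)
    have e: "rels #>\<^bsub>F\<^esub> (c - d) = (rels #>\<^bsub>F\<^esub> c) \<oplus>\<^bsub>T\<^esub> (rels #>\<^bsub>F\<^esub> (-d))"
      "\<ominus>\<^bsub>T\<^esub> (rels #>\<^bsub>F\<^esub> (c - d)) = (rels #>\<^bsub>F\<^esub> (-c)) \<oplus>\<^bsub>T\<^esub> (rels #>\<^bsub>F\<^esub> d)"
      using cd F.m_closed[OF cd(1,2)] F.m_closed[OF cd(4,3)]
      by (auto simp: add_tensor m)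
    have "Q (rels #>\<^bsub>F\<^esub> (c - d))"
      unfolding e(1) using cd diff m[of d] by (auto simp: carrier_tensor intro!: add)
    moreover have "Q (\<ominus>\<^bsub>T\<^esub> (rels #>\<^bsub>F\<^esub> (c - d)))"
      unfolding e(2) using cd diff m[of c] by (auto simp: carrier_tensor intro!: add)
    ultimately show ?case by blast
  next
    case (frag_of a)
    then show ?case using pure minus by (auto simp: pure_tensor_def)
  qed
  then show ?thesis using c by simp
qed

text \<open>The union in the definition of \<open>smult\<close> runs over all representatives of a
  coset. Scaling first components is an endomorphism of \<open>F\<close> preserving
  \<open>rels\<close>, so all representatives yield the same coset.\<close>

lemma smult_tensor:
  assumes r: "r \<in> carrier K" and c: "c \<in> carrier F"
  shows "r \<odot>\<^bsub>T\<^esub> (rels #>\<^bsub>F\<^esub> c) = rels #>\<^bsub>F\<^esub> frag_extend (\<lambda>(x, y). frag_of (r \<odot>\<^bsub>M\<^esub> x, y)) c"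
proof -
  define g where "g = frag_extend (\<lambda>(x, y). frag_of (r \<odot>\<^bsub>M\<^esub> x, y :: 'b))"
  have gF: "g d \<in> carrier F" if "d \<in> carrier F" for d
    unfolding g_def carrier_free_Abelian_group_iff
    by (rule order_trans[OF keys_frag_extend]) (use that r in auto)
  have g: "g \<in> hom F F" by (rule homI) (use gF in \<open>auto simp: g_def frag_extend_add\<close>)
  interpret Q: comm_group "F Mod rels" by (rule F.abelian_FactGroup[OF rels_subgroup])
  have Q: "group (F Mod rels)" ..
  have h: "(\<lambda>c. rels #>\<^bsub>F\<^esub> g c) \<in> hom F (F Mod rels)"
    using hom_compose[OF g rels.r_coset_hom_Mod] by (simp add: o_def)
  have "rels #>\<^bsub>F\<^esub> g d = \<one>\<^bsub>F Mod rels\<^esub>" if "d \<in> rels" for d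
  proof (rule group_hom_vanish_generate[OF h _ Q tensor_gens_carrier])
    show "group F" ..
    show "d \<in> generate F (tensor_gens K M N)" using that by (simp add: tensor_rels_def)
    fix e assume "e \<in> tensor_gens K M N"
    \<comment> \<open>Each generator goes to a generator of the same kind; for the scalar relation
      this uses commutativity of \<open>K\<close>.\<close>
    then have "g e \<in> tensor_gens K M N"
    proof (cases rule: tensor_gens_cases)
      case (1 x x' y)
      then show ?thesis using r
        by (simp add: g_def frag_extend_diff M.smult_r_distr tensor_gensI)
    next
      case (2 x y y')
      then show ?thesis using r by (simp add: g_def frag_extend_diff tensor_gensI)
    next
      case (3 q x y)
      then have "r \<odot>\<^bsub>M\<^esub> (q \<odot>\<^bsub>M\<^esub> x) = q \<odot>\<^bsub>M\<^esub> (r \<odot>\<^bsub>M\<^esub> x)"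
        using r M.R.m_comm[of r q] M.smult_assoc1[of r q x] M.smult_assoc1[of q r x] by simp
      then show ?thesis using r 3 by (simp add: g_def frag_extend_diff tensor_gensI)
    qed
    then have "rels #>\<^bsub>F\<^esub> g e = rels"
      by (intro rels.rcos_const gen_in_rels) auto
    then show "rels #>\<^bsub>F\<^esub> g e = \<one>\<^bsub>F Mod rels\<^esub>" by simp
  qed
  then have *: "rels #>\<^bsub>F\<^esub> g d = rels" if "d \<in> rels" for d using that by simp
  have "rels #>\<^bsub>F\<^esub> g d = rels #>\<^bsub>F\<^esub> g c" if d: "d \<in> rels #>\<^bsub>F\<^esub> c" for d
  proof -
    obtain e where e: "e \<in> rels" "d = e + c" using d by (auto simp: r_coset_def)
    have eF: "e \<in> carrier F" using e rels.subset by blast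
    have "rels #>\<^bsub>F\<^esub> g d = (rels #>\<^bsub>F\<^esub> g e) <#>\<^bsub>F\<^esub> (rels #>\<^bsub>F\<^esub> g c)"
      using rels.rcos_sum[OF gF gF, OF eF c] e by (simp add: g_def frag_extend_add)
    also have "\<dots> = rels #>\<^bsub>F\<^esub> g c"
      unfolding *[OF e(1)] using rels.rcos_sum[OF F.one_closed gF[OF c]]
      by (simp add: F.coset_mult_one[OF rels.subset, simplified])
    finally show ?thesis .
  qed
  moreover have "c \<in> rels #>\<^bsub>F\<^esub> c" by (rule F.rcos_self[OF c rels_subgroup])
  ultimately have "(\<Union>d\<in>rels #>\<^bsub>F\<^esub> c. rels #>\<^bsub>F\<^esub> g d) = rels #>\<^bsub>F\<^esub> g c" by blast
  then show ?thesis by (simp add: tensor_def Let_def g_def)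
qed

lemma smult_pure:
  assumes "r \<in> carrier K" "x \<in> carrier M" "y \<in> carrier N"
  shows "r \<odot>\<^bsub>T\<^esub> (x \<otimes>\<^sub>T y) = (r \<odot>\<^bsub>M\<^esub> x) \<otimes>\<^sub>T y"
  using assms by (simp add: pure_tensor_def smult_tensor)

lemma smult_add_tensor:
  assumes "r \<in> carrier K" "s \<in> carrier T" "t \<in> carrier T"
  shows "r \<odot>\<^bsub>T\<^esub> (s \<oplus>\<^bsub>T\<^esub> t) = r \<odot>\<^bsub>T\<^esub> s \<oplus>\<^bsub>T\<^esub> r \<odot>\<^bsub>T\<^esub> t"
proof -
  have gF: "frag_extend (\<lambda>(x, y). frag_of (r \<odot>\<^bsub>M\<^esub> x, y)) d \<in> carrier F" if "d \<in> carrier F" for d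
    unfolding carrier_free_Abelian_group_iff
    by (rule order_trans[OF keys_frag_extend]) (use that assms in auto)
  show ?thesis
    using assms F.m_closed gF
    by (auto simp: carrier_tensor add_tensor smult_tensor frag_extend_add simp del: carrier_free_Abelian_group_iff)
qed

lemma smult_closed_tensor:
  assumes "r \<in> carrier K" "t \<in> carrier T"
  shows "r \<odot>\<^bsub>T\<^esub> t \<in> carrier T"
  using assms(2) by (induction rule: tensor_induct) (auto simp: smult_pure smult_add_tensor assms(1))

text \<open>Each axiom holds on pure tensors by the corresponding axiom for \<open>M\<close> and
  extends to all of \<open>T\<close> by additivity.\<close>

lemma module_tensor: "module K T"
proof (rule moduleI)
  show "cring K" ..
  show "abelian_group T" ..
next
  fix r s x assume rs: "r \<in> carrier K" "s \<in> carrier K" and "x \<in> carrier T"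
  from this(3) show "(r \<oplus>\<^bsub>K\<^esub> s) \<odot>\<^bsub>T\<^esub> x = r \<odot>\<^bsub>T\<^esub> x \<oplus>\<^bsub>T\<^esub> s \<odot>\<^bsub>T\<^esub> x"
    by (induction rule: tensor_induct)
       (use rs in \<open>auto simp: smult_pure smult_add_tensor smult_closed_tensor M.smult_l_distr
          pure_add_left T.a_ac\<close>)
next
  fix r s x assume rs: "r \<in> carrier K" "s \<in> carrier K" and "x \<in> carrier T"
  from this(3) show "(r \<otimes>\<^bsub>K\<^esub> s) \<odot>\<^bsub>T\<^esub> x = r \<odot>\<^bsub>T\<^esub> (s \<odot>\<^bsub>T\<^esub> x)"
    by (induction rule: tensor_induct)
       (use rs in \<open>auto simp: smult_pure smult_add_tensor smult_closed_tensor M.smult_assoc1\<close>)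
next
  fix x assume "x \<in> carrier T"
  then show "\<one>\<^bsub>K\<^esub> \<odot>\<^bsub>T\<^esub> x = x"
    by (induction rule: tensor_induct) (auto simp: smult_pure smult_add_tensor)
qed (auto simp: smult_closed_tensor smult_add_tensor)

section \<open>Evaluation of Sweedler expressions\<close>

text \<open>Bilinearity of \<open>f\<close> makes \<open>frag_eval\<close> vanish on the tensor
  relations. It is then constant on the coset, its image is a singleton, and \<open>the_elem\<close>
  returns the intended value.\<close>

lemma sweedler_coset:
  assumes P: "module K P" and f: "bilinear_map K M N P f" and c: "c \<in> carrier F"
  shows "sweedler P (rels #>\<^bsub>F\<^esub> c) f = frag_eval P (\<lambda>p. f (fst p) (snd p)) c"
proof -
  interpret P: module K P by fact
  define h where "h = frag_eval P (\<lambda>p. f (fst p) (snd p))"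
  have f': "(\<lambda>p. f (fst p) (snd p)) \<in> carrier M \<times> carrier N \<rightarrow> carrier P"
    using bilinear_map_closed[OF f] by auto
  have h: "h \<in> hom F (add_monoid P)" unfolding h_def by (rule P.frag_eval_hom[OF f'])
  interpret h: group_hom F "add_monoid P" h
    by (simp add: group_hom_def group_hom_axioms_def h P.a_group)
  have hdiff: "h (c - d) = h c \<ominus>\<^bsub>P\<^esub> h d" if "c \<in> carrier F" "d \<in> carrier F" for c d
    using that h.hom_mult[of c "inv\<^bsub>F\<^esub> d"] h.hom_inv[of d] F.inv_closed[of d]
    by (simp add: a_minus_def a_inv_def)
  have h_of: "h (frag_of (x, y)) = f x y" if "x \<in> carrier M" "y \<in> carrier N" for x y
    using that P.frag_eval_of[of "\<lambda>p. f (fst p) (snd p)" "(x, y)"] bilinear_map_closed[OF f]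
    by (simp add: h_def)
  have cl: "frag_of (x, y) - frag_of (x', y') \<in> carrier F"
    if "x \<in> carrier M" "y \<in> carrier N" "x' \<in> carrier M" "y' \<in> carrier N" for x y x' y'
    using F.m_closed[OF frag_of_F F.inv_closed[OF frag_of_F], of x y x' y'] that by simp
  note lin = linear_mapD[OF bilinear_mapD(1)[OF f]] linear_mapD[OF bilinear_mapD(2)[OF f]]
  have "h d = \<one>\<^bsub>add_monoid P\<^esub>" if "d \<in> rels" for d
  proof (rule group_hom_vanish_generate[OF h F.is_group P.a_group tensor_gens_carrier])
    show "d \<in> generate F (tensor_gens K M N)" using that by (simp add: tensor_rels_def)
    \<comment> \<open>This is the shape that the image of an additivity relation takes, in either
      argument.\<close>
    have canc: "(u \<oplus>\<^bsub>P\<^esub> v) \<ominus>\<^bsub>P\<^esub> u \<ominus>\<^bsub>P\<^esub> v = \<zero>\<^bsub>P\<^esub>" if "u \<in> carrier P" "v \<in> carrier P" for u v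
      using that P.r_neg[of "u \<oplus>\<^bsub>P\<^esub> v"] by (simp add: a_minus_def P.minus_add P.a_assoc)
    fix e assume "e \<in> tensor_gens K M N"
    then show "h e = \<one>\<^bsub>add_monoid P\<^esub>"
      unfolding tensor_gens_def
      by (elim UnE) (auto simp: hdiff h_of cl lin canc P.r_neg a_minus_def[of P "_ \<odot>\<^bsub>P\<^esub> _"]
          simp del: carrier_free_Abelian_group_iff)
  qed
  then have h_rels: "h d = \<zero>\<^bsub>P\<^esub>" if "d \<in> rels" for d using that by simp
  have "h d = h c" if d: "d \<in> rels #>\<^bsub>F\<^esub> c" for d
  proof -
    obtain e where e: "e \<in> rels" "d = e \<otimes>\<^bsub>F\<^esub> c" using d unfolding r_coset_def by blast
    then have "h d = h e \<oplus>\<^bsub>P\<^esub> h c" using rels.subset h.hom_mult[of e c] c by auto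
    then show ?thesis using h_rels[OF e(1)] h.hom_closed[OF c] by simp
  qed
  then have "h ` (rels #>\<^bsub>F\<^esub> c) = {h c}"
    using F.rcos_self[OF c rels_subgroup] by blast
  then show ?thesis by (simp add: sweedler_def h_def frag_eval_def)
qed

lemma sweedler_pure:
  assumes P: "module K P" and f: "bilinear_map K M N P f" and xy: "x \<in> carrier M" "y \<in> carrier N"
  shows "sweedler P (x \<otimes>\<^sub>T y) f = f x y"
proof -
  interpret P: module K P by fact
  show ?thesis
    using sweedler_coset[OF P f, of "frag_of (x, y)"] xy bilinear_map_closed[OF f xy]
      P.frag_eval_of[of "\<lambda>p. f (fst p) (snd p)" "(x, y)"]
    by (simp add: pure_tensor_def)
qed

lemma sweedler_add:
  assumes P: "module K P" and f: "bilinear_map K M N P f" and st: "s \<in> carrier T" "t \<in> carrier T"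
  shows "sweedler P (s \<oplus>\<^bsub>T\<^esub> t) f = sweedler P s f \<oplus>\<^bsub>P\<^esub> sweedler P t f"
proof -
  interpret P: module K P by fact
  have f': "(\<lambda>p. f (fst p) (snd p)) \<in> carrier M \<times> carrier N \<rightarrow> carrier P"
    using bilinear_map_closed[OF f] by auto
  show ?thesis
    using st F.m_closed hom_mult[OF P.frag_eval_hom[OF f']]
    by (auto simp: carrier_tensor add_tensor sweedler_coset[OF P f] simp del: carrier_free_Abelian_group_iff)
qed

lemma sweedler_closed:
  assumes P: "module K P" and f: "bilinear_map K M N P f" and t: "t \<in> carrier T"
  shows "sweedler P t f \<in> carrier P"
proof -
  interpret P: module K P by fact
  from t show ?thesis
    by (induction rule: tensor_induct)
       (auto simp: sweedler_pure[OF P f] sweedler_add[OF P f] bilinear_map_closed[OF f])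
qed

text \<open>Together with \<open>sweedler_pure\<close> this is the existence half of the universal
  property: a bilinear map factors through a linear map on \<open>T\<close>.\<close>

lemma sweedler_linear:
  assumes P: "module K P" and f: "bilinear_map K M N P f"
  shows "linear_map K T P (\<lambda>t. sweedler P t f)"
proof (rule linear_mapI)
  interpret P: module K P by fact
  fix r t assume r: "r \<in> carrier K" and "t \<in> carrier T"
  from this(2) show "sweedler P (r \<odot>\<^bsub>T\<^esub> t) f = r \<odot>\<^bsub>P\<^esub> sweedler P t f"
    by (induction rule: tensor_induct)
       (use r in \<open>auto simp: sweedler_pure[OF P f] sweedler_add[OF P f] smult_pure smult_add_tensor
         smult_closed_tensor sweedler_closed[OF P f] P.smult_r_distr
         linear_mapD(3)[OF bilinear_mapD(2)[OF f]]\<close>)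
qed (auto simp: sweedler_add[OF P f] sweedler_closed[OF P f])

lemma pure_bilinear: "bilinear_map K M N T (\<lambda>x y. x \<otimes>\<^sub>T y)"
  by (intro bilinear_mapI linear_mapI)
     (auto simp: pure_add_left pure_add_right smult_pure pure_smult_swap)

text \<open>The uniqueness half of the universal property. Most identities below are proved by
  comparing two linear maps on pure tensors.\<close>

lemma linear_map_tensor_eqI:
  assumes f: "linear_map K T P f" and g: "linear_map K T P g"
    and eq: "\<And>x y. x \<in> carrier M \<Longrightarrow> y \<in> carrier N \<Longrightarrow> f (x \<otimes>\<^sub>T y) = g (x \<otimes>\<^sub>T y)"
    and t: "t \<in> carrier T"
  shows "f t = g t"
  using t by (induction rule: tensor_induct) (auto simp: eq linear_mapD(2)[OF f] linear_mapD(2)[OF g])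

end

lemma linear_map_ident: "linear_map K M M (\<lambda>x. x)"
  by (simp add: linear_map_def)

lemma linear_map_compose:
  assumes "linear_map K N P g" "linear_map K M N f"
  shows "linear_map K M P (\<lambda>x. g (f x))"
  using assms unfolding linear_map_def by (auto simp: Pi_iff)

lemma bilinear_map_compose_left:
  assumes "bilinear_map K M N P f" "linear_map K L M g" "y \<in> carrier N"
  shows "linear_map K L P (\<lambda>x. f (g x) y)"
  by (rule linear_map_compose[OF bilinear_mapD(2)[OF assms(1,3)] assms(2)])

lemma bilinear_map_compose_right:
  assumes "bilinear_map K M N P f" "x \<in> carrier M" "linear_map K L N g"
  shows "linear_map K L P (\<lambda>y. f x (g y))"
  by (rule linear_map_compose[OF bilinear_mapD(1)[OF assms(1,2)] assms(3)])

text \<open>The module structure keeps sums and multiples inside the carrier, where \<open>f\<close>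
  and \<open>g\<close> agree.\<close>

lemma linear_map_cong:
  assumes "linear_map K M N f" "module K M" "\<And>x. x \<in> carrier M \<Longrightarrow> f x = g x"
  shows "linear_map K M N g"
proof -
  interpret M: module K M by fact
  show ?thesis using assms(1,3) unfolding linear_map_def by (auto simp: Pi_iff)
qed

lemma bilinear_map_cong:
  assumes "bilinear_map K M N P f" "module K M" "module K N"
    and "\<And>x y. x \<in> carrier M \<Longrightarrow> y \<in> carrier N \<Longrightarrow> f x y = g x y"
  shows "bilinear_map K M N P g"
proof (rule bilinear_mapI)
  show "linear_map K N P (\<lambda>y. g x y)" if "x \<in> carrier M" for x
    by (rule linear_map_cong[OF bilinear_mapD(1)[OF assms(1) that] assms(3)]) (simp add: assms(4) that)
  show "linear_map K M P (\<lambda>x. g x y)" if "y \<in> carrier N" for y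
    by (rule linear_map_cong[OF bilinear_mapD(2)[OF assms(1) that] assms(2)]) (simp add: assms(4) that)
qed

lemma linear_map_add:
  assumes f: "linear_map K M P f" and g: "linear_map K M P g"
    and M: "module K M" and P: "module K P"
  shows "linear_map K M P (\<lambda>x. f x \<oplus>\<^bsub>P\<^esub> g x)"
proof -
  interpret M: module K M by fact
  interpret P: module K P by fact
  note [simp] = linear_mapD[OF f] linear_mapD[OF g]
  show ?thesis by (rule linear_mapI) (auto simp: P.smult_r_distr P.a_ac)
qed

context two_modules begin

text \<open>Evaluates a Sweedler expression once a linear map with the prescribed values on pure tensors is
  known; it makes the bilinearity of \<open>f\<close> automatic.\<close>

lemma sweedler_eq_linear:
  assumes P: "module K P" and h: "linear_map K T P h" and t: "t \<in> carrier T"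
    and f: "\<And>x y. x \<in> carrier M \<Longrightarrow> y \<in> carrier N \<Longrightarrow> f x y = h (x \<otimes>\<^sub>T y)"
  shows "sweedler P t f = h t"
proof -
  have "bilinear_map K M N P (\<lambda>x y. h (x \<otimes>\<^sub>T y))"
    using pure_bilinear by (auto intro!: bilinear_mapI linear_map_compose[OF h] intro: bilinear_mapD)
  then have bil: "bilinear_map K M N P f"
    by (rule bilinear_map_cong) (auto simp: f M.module_axioms N.module_axioms)
  show ?thesis
    by (rule linear_map_tensor_eqI[OF sweedler_linear[OF P bil] h _ t]) (simp add: sweedler_pure[OF P bil] f)
qed

text \<open>Needed for nested Sweedler expressions, whose inner part depends on a variable bound
  outside. For pure \<open>t\<close> the value is \<open>f l x y\<close>, linear in \<open>l\<close>
  by assumption, and sums of linear maps are linear.\<close>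

lemma sweedler_linear_parameter:
  assumes L: "module K L" and P: "module K P" and t: "t \<in> carrier T"
    and f: "\<And>l. l \<in> carrier L \<Longrightarrow> bilinear_map K M N P (f l)"
    and lin: "\<And>x y. x \<in> carrier M \<Longrightarrow> y \<in> carrier N \<Longrightarrow> linear_map K L P (\<lambda>l. f l x y)"
  shows "linear_map K L P (\<lambda>l. sweedler P t (f l))"
  using t
proof (induction rule: tensor_induct)
  case (pure x y)
  show ?case
    by (rule linear_map_cong[OF lin[OF pure] L]) (simp add: sweedler_pure[OF P f] pure)
next
  case (add s t)
  show ?case
    by (rule linear_map_cong[OF linear_map_add[OF add(3,4) L P] L]) (simp add: sweedler_add[OF P f] add)
qed

end

lemma two_modulesI: "module K M \<Longrightarrow> module K N \<Longrightarrow> two_modules K M N"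
  by (simp add: two_modules_def)

lemma module_tensorI: "module K M \<Longrightarrow> module K N \<Longrightarrow> module K (tensor K M N)"
  by (rule two_modules.module_tensor[OF two_modulesI])

section \<open>Tensor products of maps and associativity\<close>

lemma tensor_map_bilinear:
  assumes "module K M" "module K N" "module K M'" "module K N'"
    and "linear_map K M M' f" "linear_map K N N' g"
  shows "bilinear_map K M N (tensor K M' N') (\<lambda>x y. pure_tensor K M' N' (f x) (g y))"
proof -
  interpret T': two_modules K M' N' by (rule two_modulesI) fact+
  show ?thesis
    by (auto intro!: bilinear_mapI bilinear_map_compose_left[OF T'.pure_bilinear]
          bilinear_map_compose_right[OF T'.pure_bilinear] assms intro: linear_mapD(1)[OF assms(5)]
          linear_mapD(1)[OF assms(6)])
qed

lemma tensor_map_linear: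
  assumes "module K M" "module K N" "module K M'" "module K N'"
    and "linear_map K M M' f" "linear_map K N N' g"
  shows "linear_map K (tensor K M N) (tensor K M' N') (tensor_map K M' N' f g)"
  unfolding tensor_map_def[abs_def]
  by (rule two_modules.sweedler_linear[OF two_modulesI module_tensorI tensor_map_bilinear])
     (rule assms)+

lemma tensor_map_pure:
  assumes "module K M" "module K N" "module K M'" "module K N'"
    and "linear_map K M M' f" "linear_map K N N' g" "x \<in> carrier M" "y \<in> carrier N"
  shows "tensor_map K M' N' f g (pure_tensor K M N x y) = pure_tensor K M' N' (f x) (g y)"
  unfolding tensor_map_def
  by (rule two_modules.sweedler_pure[OF two_modulesI module_tensorI tensor_map_bilinear])
     (rule assms)+

section \<open>Associativity isomorphisms of threefold tensor products\<close>

locale three_modules = LM: two_modules K L M + MN: two_modules K M N + LN: two_modules K L N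
  for K :: "('k, 'p) ring_scheme" and L :: "('k, 'a) module" and M :: "('k, 'b) module"
    and N :: "('k, 'c) module"
begin

lemmas modules = LM.M.module_axioms LM.N.module_axioms MN.N.module_axioms

sublocale L_MN: two_modules K L "tensor K M N"
  by (intro two_modulesI module_tensorI modules)

sublocale LM_N: two_modules K "tensor K L M" N
  by (intro two_modulesI module_tensorI modules)

lemma assoc_right_inner:
  assumes "z \<in> carrier N"
  shows "bilinear_map K L M L_MN.T (\<lambda>x y. pure_tensor K L MN.T x (pure_tensor K M N y z))"
  using assms L_MN.pure_bilinear MN.pure_bilinear
  by (auto intro!: bilinear_mapI bilinear_map_compose_left[OF L_MN.pure_bilinear]
       bilinear_map_compose_right[OF L_MN.pure_bilinear] linear_map_ident intro: bilinear_mapD)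

text \<open>Linearity in \<open>s\<close> is the universal property for fixed \<open>z\<close>;
  linearity in \<open>z\<close> is linear dependence of the inner expression on a parameter.\<close>

lemma assoc_right_outer:
  "bilinear_map K LM.T N L_MN.T (\<lambda>s z. sweedler L_MN.T s (\<lambda>x y.
     pure_tensor K L MN.T x (pure_tensor K M N y z)))"
proof (rule bilinear_mapI)
  fix s assume "s \<in> carrier LM.T"
  then show "linear_map K N L_MN.T (\<lambda>z. sweedler L_MN.T s (\<lambda>x y.
     pure_tensor K L MN.T x (pure_tensor K M N y z)))"
    by (rule LM.sweedler_linear_parameter[OF modules(3) L_MN.module_tensor])
       (use MN.pure_bilinear in \<open>auto intro!: assoc_right_inner
         bilinear_map_compose_right[OF L_MN.pure_bilinear] intro: bilinear_mapD\<close>)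
qed (rule LM.sweedler_linear[OF L_MN.module_tensor assoc_right_inner])

lemma assoc_right_linear: "linear_map K LM_N.T L_MN.T (assoc_right K L M N)"
  unfolding assoc_right_def[abs_def] Let_def
  by (rule LM_N.sweedler_linear[OF L_MN.module_tensor assoc_right_outer])

lemma assoc_right_pure:
  assumes "x \<in> carrier L" "y \<in> carrier M" "z \<in> carrier N"
  shows "assoc_right K L M N (pure_tensor K LM.T N (pure_tensor K L M x y) z) =
    pure_tensor K L MN.T x (pure_tensor K M N y z)"
  using assms unfolding assoc_right_def Let_def
  by (simp add: LM_N.sweedler_pure[OF L_MN.module_tensor assoc_right_outer]
      LM.sweedler_pure[OF L_MN.module_tensor assoc_right_inner])

lemma assoc_left_inner:
  assumes "x \<in> carrier L"
  shows "bilinear_map K M N LM_N.T (\<lambda>y z. pure_tensor K LM.T N (pure_tensor K L M x y) z)"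
  using assms LM_N.pure_bilinear LM.pure_bilinear
  by (auto intro!: bilinear_mapI bilinear_map_compose_left[OF LM_N.pure_bilinear]
       bilinear_map_compose_right[OF LM_N.pure_bilinear] linear_map_ident intro: bilinear_mapD)

lemma assoc_left_outer:
  "bilinear_map K L MN.T LM_N.T (\<lambda>x s. sweedler LM_N.T s (\<lambda>y z.
     pure_tensor K LM.T N (pure_tensor K L M x y) z))"
proof (rule bilinear_mapI)
  fix s assume "s \<in> carrier MN.T"
  then show "linear_map K L LM_N.T (\<lambda>x. sweedler LM_N.T s (\<lambda>y z.
     pure_tensor K LM.T N (pure_tensor K L M x y) z))"
    by (rule MN.sweedler_linear_parameter[OF modules(1) LM_N.module_tensor])
       (use LM.pure_bilinear in \<open>auto intro!: assoc_left_inner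
         bilinear_map_compose_left[OF LM_N.pure_bilinear] intro: bilinear_mapD\<close>)
qed (rule MN.sweedler_linear[OF LM_N.module_tensor assoc_left_inner])

lemma assoc_left_linear: "linear_map K L_MN.T LM_N.T (assoc_left K L M N)"
  unfolding assoc_left_def[abs_def] Let_def
  by (rule L_MN.sweedler_linear[OF LM_N.module_tensor assoc_left_outer])

lemma assoc_left_pure:
  assumes "x \<in> carrier L" "y \<in> carrier M" "z \<in> carrier N"
  shows "assoc_left K L M N (pure_tensor K L MN.T x (pure_tensor K M N y z)) =
    pure_tensor K LM.T N (pure_tensor K L M x y) z"
  using assms unfolding assoc_left_def Let_def
  by (simp add: L_MN.sweedler_pure[OF LM_N.module_tensor assoc_left_outer]
      MN.sweedler_pure[OF LM_N.module_tensor assoc_left_inner])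

text \<open>The uniqueness half of the universal property used twice: for the outer tensor product,
  and then, with \<open>z\<close> fixed, for the inner one.\<close>

lemma linear_map_eqI_left:
  assumes f: "linear_map K LM_N.T P f" and g: "linear_map K LM_N.T P g"
    and eq: "\<And>x y z. x \<in> carrier L \<Longrightarrow> y \<in> carrier M \<Longrightarrow> z \<in> carrier N \<Longrightarrow>
      f (pure_tensor K LM.T N (pure_tensor K L M x y) z) = g (pure_tensor K LM.T N (pure_tensor K L M x y) z)"
    and t: "t \<in> carrier LM_N.T"
  shows "f t = g t"
proof (rule LM_N.linear_map_tensor_eqI[OF f g _ t])
  fix s z assume "s \<in> carrier LM.T" and z: "z \<in> carrier N"
  from this(1) show "f (pure_tensor K LM.T N s z) = g (pure_tensor K LM.T N s z)"
    by (rule LM.linear_map_tensor_eqI[OF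
          linear_map_compose[OF f bilinear_mapD(2)[OF LM_N.pure_bilinear z]]
          linear_map_compose[OF g bilinear_mapD(2)[OF LM_N.pure_bilinear z]], rotated]) (rule eq[OF _ _ z])
qed

lemma linear_map_eqI_right:
  assumes f: "linear_map K L_MN.T P f" and g: "linear_map K L_MN.T P g"
    and eq: "\<And>x y z. x \<in> carrier L \<Longrightarrow> y \<in> carrier M \<Longrightarrow> z \<in> carrier N \<Longrightarrow>
      f (pure_tensor K L MN.T x (pure_tensor K M N y z)) = g (pure_tensor K L MN.T x (pure_tensor K M N y z))"
    and t: "t \<in> carrier L_MN.T"
  shows "f t = g t"
proof (rule L_MN.linear_map_tensor_eqI[OF f g _ t])
  fix x s assume "s \<in> carrier MN.T" and x: "x \<in> carrier L"
  from this(1) show "f (pure_tensor K L MN.T x s) = g (pure_tensor K L MN.T x s)"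
    by (rule MN.linear_map_tensor_eqI[OF
          linear_map_compose[OF f bilinear_mapD(1)[OF L_MN.pure_bilinear x]]
          linear_map_compose[OF g bilinear_mapD(1)[OF L_MN.pure_bilinear x]], rotated]) (rule eq[OF x])
qed

end

lemma three_modulesI: "module K L \<Longrightarrow> module K M \<Longrightarrow> module K N \<Longrightarrow> three_modules K L M N"
  by (simp add: three_modules_def two_modules_def)

lemma assoc_algebra_module: "assoc_algebra K A \<Longrightarrow> module K A"
  by (simp add: assoc_algebra_def)

lemma mult_bilinear:
  assumes "assoc_algebra K A"
  shows "bilinear_map K A A A (\<lambda>x y. x \<otimes>\<^bsub>A\<^esub> y)"
proof -
  interpret assoc_algebra K A by fact
  show ?thesis
    by (intro bilinear_mapI linear_mapI)
       (auto simp: l_distr r_distr smult_mult_left smult_mult_right)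
qed

lemma mult_map_linear:
  assumes "assoc_algebra K A"
  shows "linear_map K (tensor K A A) A (mult_map A)"
  unfolding mult_map_def[abs_def]
  by (rule two_modules.sweedler_linear[OF two_modulesI _ mult_bilinear])
     (rule assms assoc_algebra_module)+

lemma mult_map_pure:
  assumes "assoc_algebra K A" "x \<in> carrier A" "y \<in> carrier A"
  shows "mult_map A (pure_tensor K A A x y) = x \<otimes>\<^bsub>A\<^esub> y"
  unfolding mult_map_def
  by (rule two_modules.sweedler_pure[OF two_modulesI _ mult_bilinear])
     (rule assms assoc_algebra_module)+

section \<open>The action and the product defined by a linear map \<open>R\<close>\<close>

lemma pure_bilinearI:
  "module K M \<Longrightarrow> module K N \<Longrightarrow> bilinear_map K M N (tensor K M N) (pure_tensor K M N)"
  by (rule two_modules.pure_bilinear[OF two_modulesI])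

lemma pure_closedI:
  "module K M \<Longrightarrow> module K N \<Longrightarrow> x \<in> carrier M \<Longrightarrow> y \<in> carrier N \<Longrightarrow>
    pure_tensor K M N x y \<in> carrier (tensor K M N)"
  by (rule two_modules.pure_closed[OF two_modulesI])

section \<open>Left multiplication by A and right multiplication by B on the tensor product\<close>

locale two_algebras = A: assoc_algebra K A + B: assoc_algebra K B
  for K :: "('k, 'p) ring_scheme" and A :: "('k, 'a) module" and B :: "('k, 'b) module"
begin

sublocale AB: two_modules K A B
  by (intro two_modulesI A.module_axioms B.module_axioms)

sublocale BA: two_modules K B A
  by (intro two_modulesI A.module_axioms B.module_axioms)

lemmas A_alg = A.assoc_algebra_axioms
lemmas B_alg = B.assoc_algebra_axioms
lemmas A_mod = A.module_axioms
lemmas B_mod = B.module_axioms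
lemmas T_mod = AB.module_tensor

abbreviation "T \<equiv> tensor K A B"
abbreviation pure_AB (infixl \<open>\<otimes>\<^sub>T\<close> 70) where "a \<otimes>\<^sub>T b \<equiv> pure_tensor K A B a b"

text \<open>With \<open>rmul\<close> this gives the bimodule structure on A \<otimes> B coming from
  the products of the two algebras. It replaces Sweedler indices in later formulas: x u with u in
  \<open>T\<close> stands for \<open>lmul x u\<close>, and u y for \<open>rmul u y\<close>.\<close>

definition lmul :: "'a \<Rightarrow> ('a \<times> 'b \<Rightarrow>\<^sub>0 int) set \<Rightarrow> ('a \<times> 'b \<Rightarrow>\<^sub>0 int) set" where
  "lmul a t = sweedler T t (\<lambda>x y. (a \<otimes>\<^bsub>A\<^esub> x) \<otimes>\<^sub>T y)"

definition rmul :: "('a \<times> 'b \<Rightarrow>\<^sub>0 int) set \<Rightarrow> 'b \<Rightarrow> ('a \<times> 'b \<Rightarrow>\<^sub>0 int) set" where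
  "rmul t b = sweedler T t (\<lambda>x y. x \<otimes>\<^sub>T (y \<otimes>\<^bsub>B\<^esub> b))"

lemma lmul_aux:
  assumes "a \<in> carrier A"
  shows "bilinear_map K A B T (\<lambda>x y. (a \<otimes>\<^bsub>A\<^esub> x) \<otimes>\<^sub>T y)"
  by (intro tensor_map_bilinear[where f = "\<lambda>x. a \<otimes>\<^bsub>A\<^esub> x" and g = "\<lambda>y. y"] A_mod B_mod linear_map_ident
      bilinear_mapD(1)[OF mult_bilinear[OF A_alg]] assms)

lemma rmul_aux:
  assumes "b \<in> carrier B"
  shows "bilinear_map K A B T (\<lambda>x y. x \<otimes>\<^sub>T (y \<otimes>\<^bsub>B\<^esub> b))"
  by (intro tensor_map_bilinear[where f = "\<lambda>x. x" and g = "\<lambda>y. y \<otimes>\<^bsub>B\<^esub> b"] A_mod B_mod linear_map_ident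
      bilinear_mapD(2)[OF mult_bilinear[OF B_alg]] assms)

lemma lmul_bilinear: "bilinear_map K A T T lmul"
proof (rule bilinear_mapI)
  show "linear_map K T T (lmul a)" if "a \<in> carrier A" for a
    unfolding lmul_def[abs_def] by (rule AB.sweedler_linear[OF T_mod lmul_aux[OF that]])
  show "linear_map K A T (\<lambda>a. lmul a t)" if "t \<in> carrier T" for t
    unfolding lmul_def
    by (rule AB.sweedler_linear_parameter[OF A_mod T_mod that lmul_aux])
       (auto intro!: bilinear_map_compose_left[OF AB.pure_bilinear] bilinear_mapD(2)[OF mult_bilinear[OF A_alg]])
qed

lemma rmul_bilinear: "bilinear_map K T B T rmul"
proof (rule bilinear_mapI)
  show "linear_map K T T (\<lambda>t. rmul t b)" if "b \<in> carrier B" for b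
    unfolding rmul_def by (rule AB.sweedler_linear[OF T_mod rmul_aux[OF that]])
  show "linear_map K B T (rmul t)" if "t \<in> carrier T" for t
    unfolding rmul_def[abs_def]
    by (rule AB.sweedler_linear_parameter[OF B_mod T_mod that rmul_aux])
       (auto intro!: bilinear_map_compose_right[OF AB.pure_bilinear] bilinear_mapD(1)[OF mult_bilinear[OF B_alg]])
qed

lemma lmul_pure [simp]:
  "a \<in> carrier A \<Longrightarrow> x \<in> carrier A \<Longrightarrow> y \<in> carrier B \<Longrightarrow> lmul a (x \<otimes>\<^sub>T y) = (a \<otimes>\<^bsub>A\<^esub> x) \<otimes>\<^sub>T y"
  unfolding lmul_def by (rule AB.sweedler_pure[OF T_mod lmul_aux])

lemma rmul_pure [simp]:
  "b \<in> carrier B \<Longrightarrow> x \<in> carrier A \<Longrightarrow> y \<in> carrier B \<Longrightarrow> rmul (x \<otimes>\<^sub>T y) b = x \<otimes>\<^sub>T (y \<otimes>\<^bsub>B\<^esub> b)"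
  unfolding rmul_def by (rule AB.sweedler_pure[OF T_mod rmul_aux])

lemmas lmul_closed [simp] = bilinear_map_closed[OF lmul_bilinear]
lemmas rmul_closed [simp] = bilinear_map_closed[OF rmul_bilinear]

text \<open>Linearity goals for composite expressions are solved by peeling off the outermost
  operation; every bilinear operation contributes one rule for each argument.\<close>

lemmas linear_intros =
  linear_map_ident
  bilinear_map_compose_left[OF lmul_bilinear] bilinear_map_compose_right[OF lmul_bilinear]
  bilinear_map_compose_left[OF rmul_bilinear] bilinear_map_compose_right[OF rmul_bilinear]
  bilinear_map_compose_left[OF AB.pure_bilinear] bilinear_map_compose_right[OF AB.pure_bilinear]
  bilinear_map_compose_left[OF BA.pure_bilinear] bilinear_map_compose_right[OF BA.pure_bilinear]
  bilinear_map_compose_left[OF mult_bilinear[OF A_alg]] bilinear_map_compose_right[OF mult_bilinear[OF A_alg]]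
  bilinear_map_compose_left[OF mult_bilinear[OF B_alg]] bilinear_map_compose_right[OF mult_bilinear[OF B_alg]]

lemma rmul_rmul:
  assumes "t \<in> carrier T" "b \<in> carrier B" "b' \<in> carrier B"
  shows "rmul (rmul t b) b' = rmul t (b \<otimes>\<^bsub>B\<^esub> b')"
  by (rule AB.linear_map_tensor_eqI[where P = T, OF _ _ _ assms(1)])
     (auto intro!: linear_intros simp: assms B.m_assoc)

lemma rmul_one: "t \<in> carrier T \<Longrightarrow> rmul t \<one>\<^bsub>B\<^esub> = t"
  by (rule AB.linear_map_tensor_eqI[where P = T and g = "\<lambda>x. x"]) (auto intro!: linear_intros)

lemma lmul_rmul:
  assumes "t \<in> carrier T" "a \<in> carrier A" "b \<in> carrier B"
  shows "lmul a (rmul t b) = rmul (lmul a t) b"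
  by (rule AB.linear_map_tensor_eqI[where P = T, OF _ _ _ assms(1)])
     (auto intro!: linear_intros simp: assms)

end

section \<open>The action and the twisted product of an arbitrary linear map\<close>

text \<open>Only linearity of \<open>R\<close> is assumed, so that the locale can also be
  instantiated with the deformed map before that map is known to be a twisting map.\<close>

locale twist_setup = two_algebras K A B
  for K :: "('k, 'p) ring_scheme" and A :: "('k, 'a) module" and B :: "('k, 'b) module" +
  fixes R :: "('b \<times> 'a \<Rightarrow>\<^sub>0 int) set \<Rightarrow> ('a \<times> 'b \<Rightarrow>\<^sub>0 int) set"
  assumes R_linear: "linear_map K (tensor K B A) (tensor K A B) R"
begin

abbreviation pure_BA (infixl \<open>\<otimes>\<^sub>S\<close> 70) where "b \<otimes>\<^sub>S a \<equiv> pure_tensor K B A b a"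

lemmas R_intro = linear_map_compose[OF R_linear]
lemmas R_closed [simp] = linear_mapD(1)[OF R_linear]

definition lact :: "'b \<Rightarrow> ('a \<times> 'b \<Rightarrow>\<^sub>0 int) set \<Rightarrow> ('a \<times> 'b \<Rightarrow>\<^sub>0 int) set" where
  "lact b t = sweedler T t (\<lambda>x y. rmul (R (b \<otimes>\<^sub>S x)) y)"

lemma lact_aux:
  assumes "b \<in> carrier B"
  shows "bilinear_map K A B T (\<lambda>x y. rmul (R (b \<otimes>\<^sub>S x)) y)"
  using assms by (auto intro!: bilinear_mapI linear_intros R_intro)

lemma lact_bilinear: "bilinear_map K B T T lact"
proof (rule bilinear_mapI)
  show "linear_map K T T (lact b)" if "b \<in> carrier B" for b
    unfolding lact_def[abs_def] by (rule AB.sweedler_linear[OF T_mod lact_aux[OF that]])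
  show "linear_map K B T (\<lambda>b. lact b t)" if "t \<in> carrier T" for t
    unfolding lact_def
    by (rule AB.sweedler_linear_parameter[OF B_mod T_mod that lact_aux])
       (auto intro!: linear_intros R_intro)
qed

lemma lact_pure [simp]:
  "b \<in> carrier B \<Longrightarrow> x \<in> carrier A \<Longrightarrow> y \<in> carrier B \<Longrightarrow> lact b (x \<otimes>\<^sub>T y) = rmul (R (b \<otimes>\<^sub>S x)) y"
  unfolding lact_def by (rule AB.sweedler_pure[OF T_mod lact_aux])

lemmas lact_closed [simp] = bilinear_map_closed[OF lact_bilinear]

lemmas lact_intros = linear_intros R_intro
  bilinear_map_compose_left[OF lact_bilinear] bilinear_map_compose_right[OF lact_bilinear]

text \<open>The twisted product written as (x \<otimes> y) t = x (y \<triangleright> t), where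
  \<triangleright> is \<open>lact\<close>. Associativity is not presupposed.\<close>

definition tprod ::
    "('a \<times> 'b \<Rightarrow>\<^sub>0 int) set \<Rightarrow> ('a \<times> 'b \<Rightarrow>\<^sub>0 int) set \<Rightarrow> ('a \<times> 'b \<Rightarrow>\<^sub>0 int) set" where
  "tprod s t = sweedler T s (\<lambda>x y. lmul x (lact y t))"

lemma tprod_aux:
  assumes "t \<in> carrier T"
  shows "bilinear_map K A B T (\<lambda>x y. lmul x (lact y t))"
  using assms by (auto intro!: bilinear_mapI lact_intros)

lemma tprod_bilinear: "bilinear_map K T T T tprod"
proof (rule bilinear_mapI)
  show "linear_map K T T (\<lambda>s. tprod s t)" if "t \<in> carrier T" for t
    unfolding tprod_def by (rule AB.sweedler_linear[OF T_mod tprod_aux[OF that]])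
  show "linear_map K T T (tprod s)" if "s \<in> carrier T" for s
    unfolding tprod_def[abs_def]
    by (rule AB.sweedler_linear_parameter[OF T_mod T_mod that tprod_aux])
       (auto intro!: lact_intros)
qed

lemma tprod_pure [simp]:
  "t \<in> carrier T \<Longrightarrow> x \<in> carrier A \<Longrightarrow> y \<in> carrier B \<Longrightarrow> tprod (x \<otimes>\<^sub>T y) t = lmul x (lact y t)"
  unfolding tprod_def by (rule AB.sweedler_pure[OF T_mod tprod_aux])

lemmas tprod_closed [simp] = bilinear_map_closed[OF tprod_bilinear]

lemmas tprod_intros = lact_intros
  bilinear_map_compose_left[OF tprod_bilinear] bilinear_map_compose_right[OF tprod_bilinear]

text \<open>On x \<otimes> y both sides are R (b \<otimes> x) (y b'), because y enters the action
  only as a right factor. This holds for any linear \<open>R\<close>.\<close>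

lemma lact_rmul:
  assumes "t \<in> carrier T" "b \<in> carrier B" "b' \<in> carrier B"
  shows "lact b (rmul t b') = rmul (lact b t) b'"
  by (rule AB.linear_map_tensor_eqI[where P = T, OF _ _ _ assms(1)])
     (auto intro!: lact_intros simp: assms rmul_rmul)

lemma tprod_rmul:
  assumes "s \<in> carrier T" "t \<in> carrier T" "b \<in> carrier B"
  shows "tprod s (rmul t b) = rmul (tprod s t) b"
  by (rule AB.linear_map_tensor_eqI[where P = T, OF _ _ _ assms(1)])
     (auto intro!: tprod_intros simp: assms lact_rmul lmul_rmul)

lemma twisted_tensor_mult:
  assumes s: "s \<in> carrier T" and t: "t \<in> carrier T"
  shows "s \<otimes>\<^bsub>twisted_tensor K A B R\<^esub> t = tprod s t"
proof -
  \<comment> \<open>The nested sums are eliminated from the inside outwards; at each stage the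
    summand is the value on a pure tensor of a known linear map.\<close>
  have inner: "sweedler T (R (y \<otimes>\<^sub>S x')) (\<lambda>xR yR. (x \<otimes>\<^bsub>A\<^esub> xR) \<otimes>\<^sub>T (yR \<otimes>\<^bsub>B\<^esub> y'))
      = lmul x (lact y (x' \<otimes>\<^sub>T y'))"
    if "x \<in> carrier A" "y \<in> carrier B" "x' \<in> carrier A" "y' \<in> carrier B" for x y x' y'
    unfolding lact_pure[OF that(2,3,4)]
    by (rule AB.sweedler_eq_linear[OF T_mod])
       (auto intro!: lact_intros simp: that)
  have "sweedler T t (\<lambda>x' y'. sweedler T (R (y \<otimes>\<^sub>S x')) (\<lambda>xR yR. (x \<otimes>\<^bsub>A\<^esub> xR) \<otimes>\<^sub>T (yR \<otimes>\<^bsub>B\<^esub> y')))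
      = lmul x (lact y t)"
    if "x \<in> carrier A" "y \<in> carrier B" for x y
    by (rule AB.sweedler_eq_linear[OF T_mod _ t])
       (auto intro!: lact_intros simp: that inner)
  then have "sweedler T s (\<lambda>x y. sweedler T t (\<lambda>x' y'.
      sweedler T (R (y \<otimes>\<^sub>S x')) (\<lambda>xR yR. (x \<otimes>\<^bsub>A\<^esub> xR) \<otimes>\<^sub>T (yR \<otimes>\<^bsub>B\<^esub> y')))) = tprod s t"
    by (intro AB.sweedler_eq_linear[OF T_mod _ s])
       (auto intro!: tprod_intros simp: t)
  then show ?thesis by (simp add: twisted_tensor_def)
qed

section \<open>The hexagon identities on pure tensors\<close>

text \<open>The composites on the right of the two axioms of \<open>twisting_map\<close>, with
  \<open>\<lambda>x. x\<close> in place of \<open>id\<close> so that the linearity rules for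
  identity maps match.\<close>

abbreviation "hexagon_A \<equiv>
  tensor_map K A B (mult_map A) (\<lambda>x. x) \<circ> assoc_left K A A B
        \<circ> tensor_map K A (tensor K A B) (\<lambda>x. x) R \<circ> assoc_right K A B A
        \<circ> tensor_map K (tensor K A B) A R (\<lambda>x. x) \<circ> assoc_left K B A A"

abbreviation "hexagon_B \<equiv>
  tensor_map K A B (\<lambda>x. x) (mult_map B) \<circ> assoc_right K A B B
        \<circ> tensor_map K (tensor K A B) B R (\<lambda>x. x) \<circ> assoc_left K B A B
        \<circ> tensor_map K B (tensor K A B) (\<lambda>x. x) R \<circ> assoc_right K B B A"

lemmas BAA = three_modulesI[OF B_mod A_mod A_mod]
lemmas BBA = three_modulesI[OF B_mod B_mod A_mod]
lemmas ABA = three_modulesI[OF A_mod B_mod A_mod]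
lemmas BAB = three_modulesI[OF B_mod A_mod B_mod]
lemmas AAB = three_modulesI[OF A_mod A_mod B_mod]
lemmas ABB = three_modulesI[OF A_mod B_mod B_mod]

lemmas AA_mod = module_tensorI[OF A_mod A_mod]
lemmas BB_mod = module_tensorI[OF B_mod B_mod]
lemmas BA_mod = module_tensorI[OF B_mod A_mod]

text \<open>One bundle for each tensor product of maps in the hexagons, listing facts in the order
  of the premises of \<open>tensor_map_linear\<close> and \<open>tensor_map_pure\<close>.\<close>

lemmas mult_A_id = AA_mod B_mod A_mod B_mod mult_map_linear[OF A_alg] linear_map_ident
lemmas id_mult_B = A_mod BB_mod A_mod B_mod linear_map_ident mult_map_linear[OF B_alg]
lemmas id_mult_A = B_mod AA_mod B_mod A_mod linear_map_ident mult_map_linear[OF A_alg]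
lemmas mult_B_id = BB_mod A_mod B_mod A_mod mult_map_linear[OF B_alg] linear_map_ident
lemmas A_id_R = A_mod BA_mod A_mod T_mod linear_map_ident R_linear
lemmas B_id_R = B_mod BA_mod B_mod T_mod linear_map_ident R_linear
lemmas A_R_id = BA_mod A_mod T_mod A_mod R_linear linear_map_ident
lemmas B_R_id = BA_mod B_mod T_mod B_mod R_linear linear_map_ident

lemmas tensor_map_intros =
  linear_map_compose[OF tensor_map_linear[OF mult_A_id]] linear_map_compose[OF tensor_map_linear[OF id_mult_B]]
  linear_map_compose[OF tensor_map_linear[OF id_mult_A]] linear_map_compose[OF tensor_map_linear[OF mult_B_id]]
  linear_map_compose[OF tensor_map_linear[OF A_id_R]] linear_map_compose[OF tensor_map_linear[OF B_id_R]]
  linear_map_compose[OF tensor_map_linear[OF A_R_id]] linear_map_compose[OF tensor_map_linear[OF B_R_id]]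
  linear_map_compose[OF three_modules.assoc_left_linear[OF BAA]]
  linear_map_compose[OF three_modules.assoc_left_linear[OF AAB]]
  linear_map_compose[OF three_modules.assoc_left_linear[OF BAB]]
  linear_map_compose[OF three_modules.assoc_right_linear[OF BBA]]
  linear_map_compose[OF three_modules.assoc_right_linear[OF ABA]]
  linear_map_compose[OF three_modules.assoc_right_linear[OF ABB]]

lemmas tensor_map_simps =
  tensor_map_pure[OF mult_A_id] tensor_map_pure[OF id_mult_B] tensor_map_pure[OF id_mult_A]
  tensor_map_pure[OF mult_B_id] tensor_map_pure[OF A_id_R] tensor_map_pure[OF B_id_R]
  tensor_map_pure[OF A_R_id] tensor_map_pure[OF B_R_id]
  three_modules.assoc_left_pure[OF BAA] three_modules.assoc_left_pure[OF AAB]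
  three_modules.assoc_left_pure[OF BAB] three_modules.assoc_right_pure[OF BBA]
  three_modules.assoc_right_pure[OF ABA] three_modules.assoc_right_pure[OF ABB]
  mult_map_pure[OF A_alg] mult_map_pure[OF B_alg]
  pure_closedI A_mod B_mod AA_mod BB_mod

lemma R_mult_A_linear:
  "linear_map K (tensor K B (tensor K A A)) T (\<lambda>t. R (tensor_map K B A (\<lambda>x. x) (mult_map A) t))"
  by (intro R_intro tensor_map_intros linear_map_ident)

lemma R_mult_B_linear:
  "linear_map K (tensor K (tensor K B B) A) T (\<lambda>t. R (tensor_map K B A (mult_map B) (\<lambda>x. x) t))"
  by (intro R_intro tensor_map_intros linear_map_ident)

lemma hexagon_A_linear: "linear_map K (tensor K B (tensor K A A)) T (\<lambda>t. hexagon_A t)"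
  unfolding comp_def by (intro tensor_map_intros linear_map_ident)

lemma hexagon_B_linear: "linear_map K (tensor K (tensor K B B) A) T (\<lambda>t. hexagon_B t)"
  unfolding comp_def by (intro tensor_map_intros linear_map_ident)

text \<open>If R (b \<otimes> a) = x \<otimes> y, the composite yields x R (y \<otimes> a'), which
  is x (y \<triangleright> (a' \<otimes> 1)). The factor 1 turns a' into an element of
  \<open>T\<close>.\<close>

lemma hexagon_A_pure:
  assumes b: "b \<in> carrier B" and a: "a \<in> carrier A" "a' \<in> carrier A"
  shows "hexagon_A (pure_tensor K B (tensor K A A) b (pure_tensor K A A a a')) =
    tprod (R (b \<otimes>\<^sub>S a)) (a' \<otimes>\<^sub>T \<one>\<^bsub>B\<^esub>)"
proof -
  \<comment> \<open>The last two maps of the composite multiply x into the first factor of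
    u.\<close>
  have 1: "tensor_map K A B (mult_map A) (\<lambda>x. x) (assoc_left K A A B (pure_tensor K A T x u)) = lmul x u"
    if x: "x \<in> carrier A" and u: "u \<in> carrier T" for x u
  proof (rule AB.linear_map_tensor_eqI[where P = T, OF _ _ _ u])
    show "linear_map K T T (\<lambda>u. tensor_map K A B (mult_map A) (\<lambda>x. x) (assoc_left K A A B (pure_tensor K A T x u)))"
      by (intro tensor_map_intros bilinear_mapD(1)[OF pure_bilinearI[OF A_mod T_mod] x])
  qed (use x in \<open>auto intro!: linear_intros simp: tensor_map_simps\<close>)
  \<comment> \<open>R (b \<otimes> a) is replaced by an arbitrary s in \<open>T\<close>, which
    allows reduction to pure tensors.\<close>
  have "tensor_map K A B (mult_map A) (\<lambda>x. x) (assoc_left K A A B (tensor_map K A T (\<lambda>x. x) R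
      (assoc_right K A B A (pure_tensor K T A s a')))) = tprod s (a' \<otimes>\<^sub>T \<one>\<^bsub>B\<^esub>)" if s: "s \<in> carrier T" for s
  proof (rule AB.linear_map_tensor_eqI[where P = T, OF _ _ _ s])
    show "linear_map K T T (\<lambda>s. tensor_map K A B (mult_map A) (\<lambda>x. x) (assoc_left K A A B (tensor_map K A T (\<lambda>x. x) R
      (assoc_right K A B A (pure_tensor K T A s a')))))"
      by (intro tensor_map_intros bilinear_mapD(2)[OF pure_bilinearI[OF T_mod A_mod] a(2)])
  qed (use a in \<open>auto intro!: tprod_intros simp: tensor_map_simps 1 rmul_one\<close>)
  then show ?thesis
    using a b by (simp add: tensor_map_simps)
qed

text \<open>If R (b' \<otimes> a) = x \<otimes> y, the composite applies \<open>R\<close> to b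
  \<otimes> x and multiplies by y on the right, which is the definition of b \<triangleright> (x
  \<otimes> y).\<close>

lemma hexagon_B_pure:
  assumes b: "b \<in> carrier B" "b' \<in> carrier B" and a: "a \<in> carrier A"
  shows "hexagon_B (pure_tensor K (tensor K B B) A (pure_tensor K B B b b') a) = lact b (R (b' \<otimes>\<^sub>S a))"
proof -
  have 1: "tensor_map K A B (\<lambda>x. x) (mult_map B) (assoc_right K A B B (pure_tensor K T B u y)) = rmul u y"
    if y: "y \<in> carrier B" and u: "u \<in> carrier T" for y u
  proof (rule AB.linear_map_tensor_eqI[where P = T, OF _ _ _ u])
    show "linear_map K T T (\<lambda>u. tensor_map K A B (\<lambda>x. x) (mult_map B) (assoc_right K A B B (pure_tensor K T B u y)))"
      by (intro tensor_map_intros bilinear_mapD(2)[OF pure_bilinearI[OF T_mod B_mod] y])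
  qed (use y in \<open>auto intro!: linear_intros simp: tensor_map_simps\<close>)
  have "tensor_map K A B (\<lambda>x. x) (mult_map B) (assoc_right K A B B (tensor_map K T B R (\<lambda>x. x)
      (assoc_left K B A B (pure_tensor K B T b s)))) = lact b s" if s: "s \<in> carrier T" for s
  proof (rule AB.linear_map_tensor_eqI[where P = T, OF _ _ _ s])
    show "linear_map K T T (\<lambda>s. tensor_map K A B (\<lambda>x. x) (mult_map B) (assoc_right K A B B (tensor_map K T B R (\<lambda>x. x)
      (assoc_left K B A B (pure_tensor K B T b s)))))"
      by (intro tensor_map_intros bilinear_mapD(1)[OF pure_bilinearI[OF B_mod T_mod] b(1)])
  qed (use b in \<open>auto intro!: tprod_intros simp: tensor_map_simps 1\<close>)
  then show ?thesis
    using a b by (simp add: tensor_map_simps)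
qed

text \<open>Both sides of each hexagon are linear, so they need only be compared on threefold pure
  tensors. There they become statements about \<open>lact\<close> and \<open>tprod\<close> that
  avoid associativity maps.\<close>

lemma twisting_map_iff:
  "twisting_map K A B R \<longleftrightarrow>
     (\<forall>b\<in>carrier B. \<forall>a\<in>carrier A. \<forall>a'\<in>carrier A.
        R (b \<otimes>\<^sub>S (a \<otimes>\<^bsub>A\<^esub> a')) = tprod (R (b \<otimes>\<^sub>S a)) (a' \<otimes>\<^sub>T \<one>\<^bsub>B\<^esub>)) \<and>
     (\<forall>b\<in>carrier B. \<forall>b'\<in>carrier B. \<forall>a\<in>carrier A.
        R ((b \<otimes>\<^bsub>B\<^esub> b') \<otimes>\<^sub>S a) = lact b (R (b' \<otimes>\<^sub>S a)))" (is "_ \<longleftrightarrow> ?A \<and> ?B")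
proof -
  have A_iff: "(\<forall>t\<in>carrier (tensor K B (tensor K A A)). R (tensor_map K B A (\<lambda>x. x) (mult_map A) t) = hexagon_A t) \<longleftrightarrow> ?A"
  proof (intro iffI ballI)
    fix b a a' assume *: "b \<in> carrier B" "a \<in> carrier A" "a' \<in> carrier A"
    assume "\<forall>t\<in>carrier (tensor K B (tensor K A A)). R (tensor_map K B A (\<lambda>x. x) (mult_map A) t) = hexagon_A t"
    from bspec[OF this, of "pure_tensor K B (tensor K A A) b (pure_tensor K A A a a')"]
    show "R (b \<otimes>\<^sub>S (a \<otimes>\<^bsub>A\<^esub> a')) = tprod (R (b \<otimes>\<^sub>S a)) (a' \<otimes>\<^sub>T \<one>\<^bsub>B\<^esub>)"
      using * by (simp only: hexagon_A_pure)
        (simp add: tensor_map_simps)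
  next
    fix t assume A: ?A and t: "t \<in> carrier (tensor K B (tensor K A A))"
    show "R (tensor_map K B A (\<lambda>x. x) (mult_map A) t) = hexagon_A t"
    proof (rule three_modules.linear_map_eqI_right[OF BAA R_mult_A_linear hexagon_A_linear _ t])
      fix b a a' assume *: "b \<in> carrier B" "a \<in> carrier A" "a' \<in> carrier A"
      show "R (tensor_map K B A (\<lambda>x. x) (mult_map A) (pure_tensor K B (tensor K A A) b (pure_tensor K A A a a')))
        = hexagon_A (pure_tensor K B (tensor K A A) b (pure_tensor K A A a a'))"
        unfolding hexagon_A_pure[OF *] using A *
        by (simp add: tensor_map_simps)
    qed
  qed
  have B_iff: "(\<forall>t\<in>carrier (tensor K (tensor K B B) A). R (tensor_map K B A (mult_map B) (\<lambda>x. x) t) = hexagon_B t) \<longleftrightarrow> ?B"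
  proof (intro iffI ballI)
    fix b b' a assume *: "b \<in> carrier B" "b' \<in> carrier B" "a \<in> carrier A"
    assume "\<forall>t\<in>carrier (tensor K (tensor K B B) A). R (tensor_map K B A (mult_map B) (\<lambda>x. x) t) = hexagon_B t"
    from bspec[OF this, of "pure_tensor K (tensor K B B) A (pure_tensor K B B b b') a"]
    show "R ((b \<otimes>\<^bsub>B\<^esub> b') \<otimes>\<^sub>S a) = lact b (R (b' \<otimes>\<^sub>S a))"
      using * by (simp only: hexagon_B_pure)
        (simp add: tensor_map_simps)
  next
    fix t assume B: ?B and t: "t \<in> carrier (tensor K (tensor K B B) A)"
    show "R (tensor_map K B A (mult_map B) (\<lambda>x. x) t) = hexagon_B t"
    proof (rule three_modules.linear_map_eqI_left[OF BBA R_mult_B_linear hexagon_B_linear _ t])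
      fix b b' a assume *: "b \<in> carrier B" "b' \<in> carrier B" "a \<in> carrier A"
      show "R (tensor_map K B A (mult_map B) (\<lambda>x. x) (pure_tensor K (tensor K B B) A (pure_tensor K B B b b') a))
        = hexagon_B (pure_tensor K (tensor K B B) A (pure_tensor K B B b b') a)"
        unfolding hexagon_B_pure[OF *] using B *
        by (simp add: tensor_map_simps)
    qed
  qed
  have "twisting_map K A B R \<longleftrightarrow>
     (\<forall>t\<in>carrier (tensor K B (tensor K A A)). R (tensor_map K B A (\<lambda>x. x) (mult_map A) t) = hexagon_A t) \<and>
     (\<forall>t\<in>carrier (tensor K (tensor K B B) A). R (tensor_map K B A (mult_map B) (\<lambda>x. x) t) = hexagon_B t)"
    using A_alg B_alg R_linear by (auto simp: twisting_map_def twisting_map_axioms_def id_def)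
  then show ?thesis unfolding A_iff B_iff .
qed

end

section \<open>Consequences of the hexagon identities\<close>

locale twist = twist_setup K A B R
  for K :: "('k, 'p) ring_scheme" and A :: "('k, 'a) module" and B :: "('k, 'b) module" and R +
  assumes R_mult_A: "\<lbrakk>b \<in> carrier B; a \<in> carrier A; a' \<in> carrier A\<rbrakk> \<Longrightarrow>
      R (b \<otimes>\<^sub>S (a \<otimes>\<^bsub>A\<^esub> a')) = tprod (R (b \<otimes>\<^sub>S a)) (a' \<otimes>\<^sub>T \<one>\<^bsub>B\<^esub>)"
    and R_mult_B: "\<lbrakk>b \<in> carrier B; b' \<in> carrier B; a \<in> carrier A\<rbrakk> \<Longrightarrow>
      R ((b \<otimes>\<^bsub>B\<^esub> b') \<otimes>\<^sub>S a) = lact b (R (b' \<otimes>\<^sub>S a))"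
begin

text \<open>On x \<otimes> y: R (b b' \<otimes> x) y = (b \<triangleright> R (b' \<otimes> x)) y = b
  \<triangleright> (R (b' \<otimes> x) y), by the second hexagon and right
  \<open>B\<close>-linearity.\<close>

lemma lact_lact:
  assumes "t \<in> carrier T" "b \<in> carrier B" "b' \<in> carrier B"
  shows "lact (b \<otimes>\<^bsub>B\<^esub> b') t = lact b (lact b' t)"
  by (rule AB.linear_map_tensor_eqI[where P = T, OF _ _ _ assms(1)])
     (auto intro!: lact_intros simp: assms R_mult_B lact_rmul)

lemma lact_lmul:
  assumes "t \<in> carrier T" "b \<in> carrier B" "a \<in> carrier A"
  shows "lact b (lmul a t) = tprod (R (b \<otimes>\<^sub>S a)) t"
proof (rule AB.linear_map_tensor_eqI[where P = T, OF _ _ _ assms(1)])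
  fix x y assume xy: "x \<in> carrier A" "y \<in> carrier B"
  \<comment> \<open>Since both sides are right \<open>B\<close>-linear in the tensor, writing x
    \<otimes> y = (x \<otimes> 1) y leaves the case t = x \<otimes> 1, which is the first
    hexagon.\<close>
  have "tprod (R (b \<otimes>\<^sub>S a)) (x \<otimes>\<^sub>T y) = tprod (R (b \<otimes>\<^sub>S a)) (rmul (x \<otimes>\<^sub>T \<one>\<^bsub>B\<^esub>) y)"
    using xy by simp
  then show "lact b (lmul a (x \<otimes>\<^sub>T y)) = tprod (R (b \<otimes>\<^sub>S a)) (x \<otimes>\<^sub>T y)"
    using assms xy by (simp add: R_mult_A tprod_rmul del: rmul_pure)
qed (auto intro!: tprod_intros simp: assms)

text \<open>For s = x \<otimes> y this is x (y b \<triangleright> t) = x (y \<triangleright> (b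
  \<triangleright> t)), that is, \<open>lact_lact\<close>.\<close>

lemma tprod_lact:
  assumes "s \<in> carrier T" "t \<in> carrier T" "b \<in> carrier B"
  shows "tprod (rmul s b) t = tprod s (lact b t)"
  by (rule AB.linear_map_tensor_eqI[where P = T, OF _ _ _ assms(1)])
     (auto intro!: tprod_intros simp: assms lact_lact)

text \<open>For s = x \<otimes> y: b \<triangleright> (x (y \<triangleright> t)) = R (b \<otimes> x)
  (y \<triangleright> t) = (R (b \<otimes> x) y) t, by \<open>lact_lmul\<close> and
  \<open>tprod_lact\<close>.\<close>

lemma lact_tprod:
  assumes "s \<in> carrier T" "t \<in> carrier T" "b \<in> carrier B"
  shows "lact b (tprod s t) = tprod (lact b s) t"
  by (rule AB.linear_map_tensor_eqI[where P = T, OF _ _ _ assms(1)])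
     (auto intro!: tprod_intros simp: assms lact_lmul tprod_lact)

end

lemma twist_setupI:
  "assoc_algebra K A \<Longrightarrow> assoc_algebra K B \<Longrightarrow> linear_map K (tensor K B A) (tensor K A B) R \<Longrightarrow>
    twist_setup K A B R"
  by (simp add: twist_setup_def two_algebras_def twist_setup_axioms_def)

lemma twistI:
  assumes "twisting_map K A B R"
  shows "twist K A B R"
proof -
  interpret twisting_map K A B R by fact
  interpret twist_setup K A B R
    by (intro twist_setupI A.assoc_algebra_axioms B.assoc_algebra_axioms linear)
  show ?thesis
    using assms unfolding twisting_map_iff
    by (auto simp: twist_def twist_axioms_def twist_setup_axioms)
qed

section \<open>The deformed algebra\<close>

text \<open>Tensor products depend only on carrier, addition and scalar multiplication, all shared
  by the deformed algebra and \<open>A\<close>. As simplification rules these equations move every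
  tensor back to \<open>A\<close>.\<close>

lemma tensor_deformed_algebra [simp]:
  "tensor K (deformed_algebra K A B \<mu> \<rho>) N = tensor K A N"
  "tensor K N (deformed_algebra K A B \<mu> \<rho>) = tensor K N A"
  "pure_tensor K (deformed_algebra K A B \<mu> \<rho>) N = pure_tensor K A N"
  "pure_tensor K N (deformed_algebra K A B \<mu> \<rho>) = pure_tensor K N A"
  by (simp_all add: fun_eq_iff tensor_def pure_tensor_def tensor_rels_def tensor_gens_def deformed_algebra_def)

lemma deformed_algebra_simps [simp]:
  "carrier (deformed_algebra K A B \<mu> \<rho>) = carrier A"
  "monoid.mult (deformed_algebra K A B \<mu> \<rho>) = deformed_mult K A B \<mu> \<rho>"
  "one (deformed_algebra K A B \<mu> \<rho>) = one A"
  "ring.zero (deformed_algebra K A B \<mu> \<rho>) = ring.zero A"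
  "ring.add (deformed_algebra K A B \<mu> \<rho>) = ring.add A"
  "smult (deformed_algebra K A B \<mu> \<rho>) = smult A"
  by (simp_all add: deformed_algebra_def)

lemma linear_map_deformed_algebra [simp]:
  "linear_map K (deformed_algebra K A B \<mu> \<rho>) N f \<longleftrightarrow> linear_map K A N f"
  "linear_map K M (deformed_algebra K A B \<mu> \<rho>) g \<longleftrightarrow> linear_map K M A g"
  by (simp_all add: linear_map_def)

section \<open>Associativity and unit of the deformed product\<close>

locale deformation = twist K A B R
  for K :: "('k, 'p) ring_scheme" and A :: "('k, 'a) module" and B :: "('k, 'b) module" and R +
  fixes \<mu> :: "('b \<times> 'a \<Rightarrow>\<^sub>0 int) set \<Rightarrow> 'a" and \<rho> :: "'a \<Rightarrow> ('a \<times> 'b \<Rightarrow>\<^sub>0 int) set"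
  assumes \<mu>_linear: "linear_map K (tensor K B A) A \<mu>"
    and \<rho>_linear: "linear_map K A (tensor K A B) \<rho>"
    and \<rho>_one: "\<rho> \<one>\<^bsub>A\<^esub> = \<one>\<^bsub>A\<^esub> \<otimes>\<^sub>T \<one>\<^bsub>B\<^esub>"
    and \<mu>_one: "a \<in> carrier A \<Longrightarrow> \<mu> (\<one>\<^bsub>B\<^esub> \<otimes>\<^sub>S a) = a"
    and deformed_right_one: "a \<in> carrier A \<Longrightarrow>
           sweedler A (\<rho> a) (\<lambda>a0 a1. a0 \<otimes>\<^bsub>A\<^esub> \<mu> (a1 \<otimes>\<^sub>S \<one>\<^bsub>A\<^esub>)) = a"
    and \<mu>_deformed: "\<lbrakk>a \<in> carrier A; a' \<in> carrier A; b \<in> carrier B\<rbrakk> \<Longrightarrow>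
           \<mu> (b \<otimes>\<^sub>S deformed_mult K A B \<mu> \<rho> a a') =
           sweedler A (\<rho> a) (\<lambda>a0 a1.
           sweedler A (R (b \<otimes>\<^sub>S a0)) (\<lambda>a0R bR.
             a0R \<otimes>\<^bsub>A\<^esub> \<mu> ((bR \<otimes>\<^bsub>B\<^esub> a1) \<otimes>\<^sub>S a')))"
    and \<rho>_deformed: "\<lbrakk>a \<in> carrier A; a' \<in> carrier A\<rbrakk> \<Longrightarrow>
           \<rho> (deformed_mult K A B \<mu> \<rho> a a') =
           sweedler (tensor K A B) (\<rho> a) (\<lambda>a0 a1.
           sweedler (tensor K A B) (\<rho> a') (\<lambda>a'0 a'1.
           sweedler (tensor K A B) (R (a1 \<otimes>\<^sub>S a'0)) (\<lambda>a'0R a1R.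
             (a0 \<otimes>\<^bsub>A\<^esub> a'0R) \<otimes>\<^sub>T (a1R \<otimes>\<^bsub>B\<^esub> a'1))))"
begin

abbreviation star (infixl \<open>\<star>\<close> 70) where "a \<star> a' \<equiv> deformed_mult K A B \<mu> \<rho> a a'"
abbreviation "D \<equiv> deformed_algebra K A B \<mu> \<rho>"

lemmas \<rho>_closed [simp] = linear_mapD(1)[OF \<rho>_linear]
lemmas \<mu>_closed [simp] = linear_mapD(1)[OF \<mu>_linear]

text \<open>Abbreviating \<open>act t a\<close> by t.a, with (x \<otimes> y).a = x \<mu> (y
  \<otimes> a), the deformed product is a * a' = \<rho> a . a'.\<close>

definition act :: "('a \<times> 'b \<Rightarrow>\<^sub>0 int) set \<Rightarrow> 'a \<Rightarrow> 'a" where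
  "act t a = sweedler A t (\<lambda>x y. x \<otimes>\<^bsub>A\<^esub> \<mu> (y \<otimes>\<^sub>S a))"

lemma star_eq_act: "a \<star> a' = act (\<rho> a) a'"
  by (simp add: deformed_mult_def act_def)

lemma act_aux:
  assumes "a \<in> carrier A"
  shows "bilinear_map K A B A (\<lambda>x y. x \<otimes>\<^bsub>A\<^esub> \<mu> (y \<otimes>\<^sub>S a))"
  using assms by (auto intro!: bilinear_mapI linear_intros linear_map_compose[OF \<mu>_linear])

lemma act_bilinear: "bilinear_map K T A A act"
proof (rule bilinear_mapI)
  show "linear_map K T A (\<lambda>t. act t a)" if "a \<in> carrier A" for a
    unfolding act_def by (rule AB.sweedler_linear[OF A_mod act_aux[OF that]])
  show "linear_map K A A (act t)" if "t \<in> carrier T" for t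
    unfolding act_def[abs_def]
    by (rule AB.sweedler_linear_parameter[OF A_mod A_mod that act_aux])
       (auto intro!: linear_intros linear_map_compose[OF \<mu>_linear])
qed

lemma act_pure [simp]:
  "a \<in> carrier A \<Longrightarrow> x \<in> carrier A \<Longrightarrow> y \<in> carrier B \<Longrightarrow> act (x \<otimes>\<^sub>T y) a = x \<otimes>\<^bsub>A\<^esub> \<mu> (y \<otimes>\<^sub>S a)"
  unfolding act_def by (rule AB.sweedler_pure[OF A_mod act_aux])

lemmas act_closed [simp] = bilinear_map_closed[OF act_bilinear]

lemmas deformation_intros = tprod_intros linear_map_compose[OF \<mu>_linear] linear_map_compose[OF \<rho>_linear]
  bilinear_map_compose_left[OF act_bilinear] bilinear_map_compose_right[OF act_bilinear]

lemma star_closed [simp]: "a \<in> carrier A \<Longrightarrow> a' \<in> carrier A \<Longrightarrow> a \<star> a' \<in> carrier A"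
  by (simp add: star_eq_act)

text \<open>The compatibility hypothesis on \<mu> with its nested sums removed: the inner sum is the
  value of (b \<triangleright> (x \<otimes> y)).a'.\<close>

lemma \<mu>_star:
  assumes "a \<in> carrier A" "a' \<in> carrier A" "b \<in> carrier B"
  shows "\<mu> (b \<otimes>\<^sub>S (a \<star> a')) = act (lact b (\<rho> a)) a'"
proof -
  have inner: "sweedler A (R (b \<otimes>\<^sub>S x)) (\<lambda>p q. p \<otimes>\<^bsub>A\<^esub> \<mu> ((q \<otimes>\<^bsub>B\<^esub> y) \<otimes>\<^sub>S a')) = act (lact b (x \<otimes>\<^sub>T y)) a'"
    if "x \<in> carrier A" "y \<in> carrier B" for x y
    unfolding lact_pure[OF assms(3) that]
    by (rule AB.sweedler_eq_linear[OF A_mod]) (auto intro!: deformation_intros simp: assms that)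
  show ?thesis
    unfolding \<mu>_deformed[OF assms]
    by (rule AB.sweedler_eq_linear[OF A_mod])
       (auto intro!: deformation_intros simp: assms inner simp del: lact_pure)
qed

lemma \<rho>_star:
  assumes "a \<in> carrier A" "a' \<in> carrier A"
  shows "\<rho> (a \<star> a') = tprod (\<rho> a) (\<rho> a')"
proof -
  have "tprod (\<rho> a) (\<rho> a') = \<rho> a \<otimes>\<^bsub>twisted_tensor K A B R\<^esub> \<rho> a'"
    using assms by (simp add: twisted_tensor_mult)
  also have "\<dots> = \<rho> (a \<star> a')" unfolding \<rho>_deformed[OF assms] by (simp add: twisted_tensor_def)
  finally show ?thesis ..
qed

lemma act_lmul:
  assumes "t \<in> carrier T" "x \<in> carrier A" "a \<in> carrier A"
  shows "act (lmul x t) a = x \<otimes>\<^bsub>A\<^esub> act t a"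
  by (rule AB.linear_map_tensor_eqI[where P = A, OF _ _ _ assms(1)])
     (auto intro!: deformation_intros simp: assms A.m_assoc)

text \<open>For s = x \<otimes> y: (x (y \<triangleright> \<rho> a)).a' = x ((y \<triangleright>
  \<rho> a).a') = x \<mu> (y \<otimes> (a * a')), by \<open>act_lmul\<close> and
  \<open>\<mu>_star\<close>.\<close>

lemma act_tprod:
  assumes "s \<in> carrier T" "a \<in> carrier A" "a' \<in> carrier A"
  shows "act (tprod s (\<rho> a)) a' = act s (a \<star> a')"
  by (rule AB.linear_map_tensor_eqI[where P = A, OF _ _ _ assms(1)])
     (auto intro!: deformation_intros simp: assms act_lmul \<mu>_star)

text \<open>Both sides equal (\<rho> a \<rho> a').a'': the left one since \<rho> is multiplicative,
  the right one by \<open>act_tprod\<close>.\<close>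

lemma star_assoc:
  assumes "a \<in> carrier A" "a' \<in> carrier A" "a'' \<in> carrier A"
  shows "(a \<star> a') \<star> a'' = a \<star> (a' \<star> a'')"
  using assms act_tprod[of "\<rho> a" a' a''] by (simp add: \<rho>_star star_eq_act[of "a \<star> a'"] star_eq_act[of a "a' \<star> a''"])

lemma star_bilinear: "bilinear_map K A A A (\<lambda>a a'. a \<star> a')"
  unfolding star_eq_act by (auto intro!: bilinear_mapI deformation_intros)

lemma assoc_algebra_D: "assoc_algebra K D"
proof -
  note lin = linear_mapD[OF bilinear_mapD(1)[OF star_bilinear]] linear_mapD[OF bilinear_mapD(2)[OF star_bilinear]]
  \<comment> \<open>The left unit law comes from \<rho> 1 = 1 \<otimes> 1 and \<mu> (1 \<otimes> a)
    = a; the right one is a hypothesis.\<close>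
  have one: "\<one>\<^bsub>A\<^esub> \<star> a = a" "a \<star> \<one>\<^bsub>A\<^esub> = a" if "a \<in> carrier A" for a
    using that deformed_right_one[OF that] by (simp_all add: star_eq_act \<rho>_one \<mu>_one) (simp add: act_def)
  have "abelian_group D"
    by (rule abelian_groupI) (auto simp: A.a_ac intro: A.l_neg)
  moreover have "monoid D"
    by (rule monoidI) (auto simp: one star_assoc)
  ultimately have "ring D"
    by (rule ringI) (auto simp: lin)
  moreover have "module K D"
    by (rule moduleI) (auto simp: A.smult_l_distr A.smult_r_distr A.smult_assoc1 \<open>abelian_group D\<close> A.R.is_cring)
  ultimately show ?thesis
    by (simp add: assoc_algebra_def assoc_algebra_axioms_def lin)
qed

end

section \<open>The deformation map, its inverse and the deformed twisting map\<close>

locale invertible_deformation = deformation K A B R \<mu> \<rho>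
  for K :: "('k, 'p) ring_scheme" and A :: "('k, 'a) module" and B :: "('k, 'b) module" and R \<mu> \<rho> +
  fixes \<Lambda> :: "'a \<Rightarrow> ('a \<times> 'b \<Rightarrow>\<^sub>0 int) set"
  assumes \<Lambda>_linear: "linear_map K A (tensor K A B) \<Lambda>"
    and \<Lambda>_\<rho>: "a \<in> carrier A \<Longrightarrow>
           sweedler (tensor K A B) (\<rho> a) (\<lambda>a0 a1.
           sweedler (tensor K A B) (\<Lambda> a0) (\<lambda>c0 c1. c0 \<otimes>\<^sub>T (c1 \<otimes>\<^bsub>B\<^esub> a1))) = a \<otimes>\<^sub>T \<one>\<^bsub>B\<^esub>"
    and \<rho>_\<Lambda>: "a \<in> carrier A \<Longrightarrow>
           sweedler (tensor K A B) (\<Lambda> a) (\<lambda>a0 a1.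
           sweedler (tensor K A B) (\<rho> a0) (\<lambda>c0 c1. c0 \<otimes>\<^sub>T (c1 \<otimes>\<^bsub>B\<^esub> a1))) = a \<otimes>\<^sub>T \<one>\<^bsub>B\<^esub>"
begin

abbreviation "\<phi> \<equiv> deformation_map K A B \<rho>"
abbreviation "\<psi> \<equiv> deformation_map K A B \<Lambda>"
abbreviation "Rd \<equiv> deformed_twisting K A B R \<rho> \<Lambda>"

lemmas \<Lambda>_closed [simp] = linear_mapD(1)[OF \<Lambda>_linear]

text \<open>The formula makes sense for any linear map f from \<open>A\<close> to \<open>T\<close>;
  stating it in this generality covers \<phi> (from \<rho>) and \<psi> (from \<Lambda>) at
  once.\<close>

lemma deformation_map_eq: "deformation_map K A B f t = sweedler T t (\<lambda>a b. rmul (f a) b)"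
  by (simp add: deformation_map_def rmul_def)

lemma deformation_map_aux:
  assumes "linear_map K A T f"
  shows "bilinear_map K A B T (\<lambda>a b. rmul (f a) b)"
  using linear_mapD(1)[OF assms]
  by (auto intro!: bilinear_mapI linear_intros linear_map_compose[OF assms])

lemma deformation_map_linear:
  assumes "linear_map K A T f"
  shows "linear_map K T T (deformation_map K A B f)"
  unfolding deformation_map_eq[abs_def] by (rule AB.sweedler_linear[OF T_mod deformation_map_aux[OF assms]])

lemma deformation_map_pure:
  assumes "linear_map K A T f" "a \<in> carrier A" "b \<in> carrier B"
  shows "deformation_map K A B f (a \<otimes>\<^sub>T b) = rmul (f a) b"
  unfolding deformation_map_eq by (rule AB.sweedler_pure[OF T_mod deformation_map_aux]) fact+

lemmas \<phi>_linear = deformation_map_linear[OF \<rho>_linear]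
lemmas \<psi>_linear = deformation_map_linear[OF \<Lambda>_linear]
lemmas \<phi>_pure [simp] = deformation_map_pure[OF \<rho>_linear]
lemmas \<psi>_pure [simp] = deformation_map_pure[OF \<Lambda>_linear]
lemmas \<phi>_closed [simp] = linear_mapD(1)[OF \<phi>_linear]
lemmas \<psi>_closed [simp] = linear_mapD(1)[OF \<psi>_linear]
lemmas \<phi>_intros = deformation_intros linear_map_compose[OF \<phi>_linear] linear_map_compose[OF \<psi>_linear]
  linear_map_compose[OF \<Lambda>_linear]

lemma deformation_map_rmul:
  assumes f: "linear_map K A T f" and t: "t \<in> carrier T" and b: "b \<in> carrier B"
  shows "deformation_map K A B f (rmul t b) = rmul (deformation_map K A B f t) b"
  by (rule AB.linear_map_tensor_eqI[where P = T, OF _ _ _ t])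
     (auto intro!: linear_intros linear_map_compose[OF deformation_map_linear[OF f]]
       simp: b deformation_map_pure[OF f] rmul_rmul linear_mapD(1)[OF f])

lemma \<psi>_\<phi>:
  assumes "t \<in> carrier T"
  shows "\<psi> (\<phi> t) = t"
proof (rule AB.linear_map_tensor_eqI[where P = T and g = "\<lambda>x. x", OF _ _ _ assms])
  fix a b assume *: "a \<in> carrier A" "b \<in> carrier B"
  \<comment> \<open>Both maps are right \<open>B\<close>-linear, so it suffices to treat a \<otimes>
    1, where the claim is the hypothesis on \<Lambda> after \<rho>.\<close>
  have "\<psi> (\<rho> a) = a \<otimes>\<^sub>T \<one>\<^bsub>B\<^esub>"
    using \<Lambda>_\<rho>[OF *(1)] by (simp add: deformation_map_def)
  with * show "\<psi> (\<phi> (a \<otimes>\<^sub>T b)) = a \<otimes>\<^sub>T b"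
    by (simp add: deformation_map_rmul[OF \<Lambda>_linear])
qed (auto intro!: \<phi>_intros)

lemma \<phi>_\<psi>:
  assumes "t \<in> carrier T"
  shows "\<phi> (\<psi> t) = t"
proof (rule AB.linear_map_tensor_eqI[where P = T and g = "\<lambda>x. x", OF _ _ _ assms])
  fix a b assume *: "a \<in> carrier A" "b \<in> carrier B"
  have "\<phi> (\<Lambda> a) = a \<otimes>\<^sub>T \<one>\<^bsub>B\<^esub>"
    using \<rho>_\<Lambda>[OF *(1)] by (simp add: deformation_map_def)
  with * show "\<phi> (\<psi> (a \<otimes>\<^sub>T b)) = a \<otimes>\<^sub>T b"
    by (simp add: deformation_map_rmul[OF \<rho>_linear])
qed (auto intro!: \<phi>_intros)

lemma \<phi>_inject:
  assumes "\<phi> s = \<phi> t" "s \<in> carrier T" "t \<in> carrier T"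
  shows "s = t"
  using assms \<psi>_\<phi> by metis

text \<open>From the inside out: the first sum is \<Lambda> p (q y) = \<psi> (p \<otimes> q y), the
  second gives \<psi> (R (b \<otimes> x) y) = \<psi> (b \<triangleright> (x \<otimes> y)), and the
  third puts \<rho> a in place of x \<otimes> y.\<close>

lemma Rd_inner:
  assumes b: "b \<in> carrier B" and a: "a \<in> carrier A"
  shows "sweedler T (\<rho> a) (\<lambda>a0 a1.
     sweedler T (R (b \<otimes>\<^sub>S a0)) (\<lambda>a0R bR.
     sweedler T (\<Lambda> a0R) (\<lambda>c0 c1. c0 \<otimes>\<^sub>T (c1 \<otimes>\<^bsub>B\<^esub> bR \<otimes>\<^bsub>B\<^esub> a1)))) = \<psi> (lact b (\<rho> a))"
proof -
  have 1: "sweedler T (\<Lambda> p) (\<lambda>c0 c1. c0 \<otimes>\<^sub>T (c1 \<otimes>\<^bsub>B\<^esub> q \<otimes>\<^bsub>B\<^esub> y)) = \<psi> (rmul (p \<otimes>\<^sub>T q) y)"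
    if "p \<in> carrier A" "q \<in> carrier B" "y \<in> carrier B" for p q y
  proof -
    have "sweedler T (\<Lambda> p) (\<lambda>c0 c1. c0 \<otimes>\<^sub>T (c1 \<otimes>\<^bsub>B\<^esub> q \<otimes>\<^bsub>B\<^esub> y)) = rmul (\<Lambda> p) (q \<otimes>\<^bsub>B\<^esub> y)"
      by (rule AB.sweedler_eq_linear[OF T_mod]) (auto intro!: \<phi>_intros simp: that B.m_assoc)
    then show ?thesis using that by simp
  qed
  have 2: "sweedler T (R (b \<otimes>\<^sub>S x)) (\<lambda>p q. sweedler T (\<Lambda> p) (\<lambda>c0 c1. c0 \<otimes>\<^sub>T (c1 \<otimes>\<^bsub>B\<^esub> q \<otimes>\<^bsub>B\<^esub> y)))
      = \<psi> (lact b (x \<otimes>\<^sub>T y))" if "x \<in> carrier A" "y \<in> carrier B" for x y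
    unfolding lact_pure[OF b that]
    by (rule AB.sweedler_eq_linear[OF T_mod]) (auto intro!: \<phi>_intros simp del: rmul_pure simp: b that 1)
  show ?thesis
    by (rule AB.sweedler_eq_linear[OF T_mod]) (auto intro!: \<phi>_intros simp: a b 2 simp del: lact_pure)
qed

lemma Rd_aux: "bilinear_map K B A T (\<lambda>b a. \<psi> (lact b (\<rho> a)))"
  by (auto intro!: bilinear_mapI \<phi>_intros)

text \<open>Bilinearity is inherited from the closed form; it is what makes the outermost Sweedler
  expression of \<open>deformed_twisting\<close> computable.\<close>

lemma Rd_aux': "bilinear_map K B A T (\<lambda>b a. sweedler T (\<rho> a) (\<lambda>a0 a1.
     sweedler T (R (b \<otimes>\<^sub>S a0)) (\<lambda>a0R bR.
     sweedler T (\<Lambda> a0R) (\<lambda>c0 c1. c0 \<otimes>\<^sub>T (c1 \<otimes>\<^bsub>B\<^esub> bR \<otimes>\<^bsub>B\<^esub> a1)))))"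
  by (rule bilinear_map_cong[OF Rd_aux B_mod A_mod]) (simp add: Rd_inner)

lemma Rd_linear: "linear_map K (tensor K B A) T Rd"
  unfolding deformed_twisting_def[abs_def] by (rule BA.sweedler_linear[OF T_mod Rd_aux'])

lemma Rd_pure:
  assumes "b \<in> carrier B" "a \<in> carrier A"
  shows "Rd (b \<otimes>\<^sub>S a) = \<psi> (lact b (\<rho> a))"
  unfolding deformed_twisting_def using BA.sweedler_pure[OF T_mod Rd_aux' assms] Rd_inner[OF assms]
  by simp

text \<open>\<open>D.lact\<close> and \<open>D.tprod\<close> are now the action and product built
  from \<open>Rd\<close> on the same module \<open>T\<close>.\<close>

sublocale D: twist_setup K D B Rd
  by (intro twist_setupI assoc_algebra_D B_alg) (simp add: Rd_linear)

text \<open>Right multiplication by \<open>B\<close> does not involve the product of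
  \<open>A\<close>, whereas \<open>D.lmul\<close> uses the deformed product.\<close>

lemma D_rmul: "D.rmul = rmul"
  by (simp add: fun_eq_iff D.rmul_def rmul_def)

lemma \<phi>_Rd:
  assumes "b \<in> carrier B" "a \<in> carrier A"
  shows "\<phi> (Rd (b \<otimes>\<^sub>S a)) = lact b (\<rho> a)"
  using assms by (simp add: Rd_pure \<phi>_\<psi>)

text \<open>On x \<otimes> y: \<phi> ((a * x) \<otimes> y) = \<rho> (a * x) y = \<rho> a (\<rho> x
  y), by multiplicativity of \<rho>.\<close>

lemma \<phi>_lmul:
  assumes "a \<in> carrier A" "t \<in> carrier T"
  shows "\<phi> (D.lmul a t) = tprod (\<rho> a) (\<phi> t)"
  by (rule AB.linear_map_tensor_eqI[where P = T, OF _ _ _ assms(2)])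
     (use assms in \<open>auto intro!: \<phi>_intros D.lmul_bilinear[THEN bilinear_mapD(1), simplified]
        simp: D.lmul_pure[simplified] \<rho>_star tprod_rmul\<close>)

text \<open>On x \<otimes> y: \<phi> (Rd (b \<otimes> x) y) = (b \<triangleright> \<rho> x) y = b
  \<triangleright> (\<rho> x y), since \<phi> and the action are right
  \<open>B\<close>-linear.\<close>

lemma \<phi>_lact:
  assumes "b \<in> carrier B" "t \<in> carrier T"
  shows "\<phi> (D.lact b t) = lact b (\<phi> t)"
  by (rule AB.linear_map_tensor_eqI[where P = T, OF _ _ _ assms(2)])
     (use assms in \<open>auto intro!: \<phi>_intros D.lact_bilinear[THEN bilinear_mapD(1), simplified]
        simp: D.lact_pure[simplified] D_rmul deformation_map_rmul[OF \<rho>_linear] \<phi>_Rd lact_rmul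
          linear_mapD(1)[OF Rd_linear]\<close>)

text \<open>For s = x \<otimes> y the left side is \<rho> x (y \<triangleright> \<phi> t) by the two
  preceding lemmas, and \<open>tprod_lact\<close> moves y to give (\<rho> x y) \<phi> t.\<close>

lemma \<phi>_tprod:
  assumes "s \<in> carrier T" "t \<in> carrier T"
  shows "\<phi> (D.tprod s t) = tprod (\<phi> s) (\<phi> t)"
  by (rule AB.linear_map_tensor_eqI[where P = T, OF _ _ _ assms(1)])
     (use assms in \<open>auto intro!: \<phi>_intros D.tprod_bilinear[THEN bilinear_mapD(2), simplified]
        simp: D.tprod_pure[simplified] \<phi>_lmul \<phi>_lact D.lact_closed[simplified] tprod_lact\<close>)

lemma twisting_map_Rd: "twisting_map K D B Rd"
  unfolding D.twisting_map_iff
proof (intro conjI ballI; simp)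
  fix b a a' assume *: "b \<in> carrier B" "a \<in> carrier A" "a' \<in> carrier A"
  \<comment> \<open>Under \<phi> this becomes b \<triangleright> (\<rho> a \<rho> a') = (b
    \<triangleright> \<rho> a) \<rho> a', an instance of \<open>lact_tprod\<close>.\<close>
  show "Rd (b \<otimes>\<^sub>S (a \<star> a')) = D.tprod (Rd (b \<otimes>\<^sub>S a)) (a' \<otimes>\<^sub>T \<one>\<^bsub>B\<^esub>)"
    by (rule \<phi>_inject)
       (use * in \<open>auto simp: \<phi>_Rd \<phi>_tprod \<rho>_star lact_tprod rmul_one linear_mapD(1)[OF Rd_linear]
          D.tprod_closed[simplified]\<close>)
next
  fix b b' a assume *: "b \<in> carrier B" "b' \<in> carrier B" "a \<in> carrier A"
  \<comment> \<open>Under \<phi> this becomes b b' \<triangleright> \<rho> a = b \<triangleright>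
    (b' \<triangleright> \<rho> a), an instance of \<open>lact_lact\<close>.\<close>
  show "Rd ((b \<otimes>\<^bsub>B\<^esub> b') \<otimes>\<^sub>S a) = D.lact b (Rd (b' \<otimes>\<^sub>S a))"
    by (rule \<phi>_inject)
       (use * in \<open>auto simp: \<phi>_Rd \<phi>_lact lact_lact linear_mapD(1)[OF Rd_linear] D.lact_closed[simplified]\<close>)
qed

text \<open>\<psi> witnesses bijectivity, \<open>\<phi>_tprod\<close> gives multiplicativity, and
  the distinguished elements correspond because \<phi> (1 \<otimes> 1) = \<rho> 1 = 1 \<otimes>
  1.\<close>

lemma algebra_iso_\<phi>: "algebra_iso K (twisted_tensor K D B Rd) (twisted_tensor K A B R) \<phi>"
proof -
  have bij: "bij_betw \<phi> (carrier T) (carrier T)"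
    by (rule bij_betw_byWitness[where f' = \<psi>]) (auto simp: \<psi>_\<phi> \<phi>_\<psi>)
  have mult: "\<phi> (s \<otimes>\<^bsub>twisted_tensor K D B Rd\<^esub> t) = \<phi> s \<otimes>\<^bsub>twisted_tensor K A B R\<^esub> \<phi> t"
    if "s \<in> carrier T" "t \<in> carrier T" for s t
    using that D.twisted_tensor_mult[of s t] by (simp add: twisted_tensor_mult \<phi>_tprod)
  have tt [simp]: "carrier (twisted_tensor K D B Rd) = carrier T" "carrier (twisted_tensor K A B R) = carrier T"
    "ring.add (twisted_tensor K D B Rd) = ring.add T" "ring.add (twisted_tensor K A B R) = ring.add T"
    "smult (twisted_tensor K D B Rd) = smult T" "smult (twisted_tensor K A B R) = smult T"
    "one (twisted_tensor K D B Rd) = \<one>\<^bsub>A\<^esub> \<otimes>\<^sub>T \<one>\<^bsub>B\<^esub>" "one (twisted_tensor K A B R) = \<one>\<^bsub>A\<^esub> \<otimes>\<^sub>T \<one>\<^bsub>B\<^esub>"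
    by (simp_all add: twisted_tensor_def)
  have "\<phi> \<in> ring_hom (twisted_tensor K D B Rd) (twisted_tensor K A B R)"
    by (rule ring_hom_memI) (auto simp: mult linear_mapD(2)[OF \<phi>_linear] \<rho>_one)
  moreover have "linear_map K (twisted_tensor K D B Rd) (twisted_tensor K A B R) \<phi>"
    using \<phi>_linear by (simp add: linear_map_def)
  ultimately show ?thesis using bij by (simp add: algebra_iso_def ring_iso_def)
qed

end

theorem theorem4p4:
  fixes K :: "('k, 'p) ring_scheme"
    and A :: "('k, 'a) module"
    and B :: "('k, 'b) module"
    and R :: "('b \<times> 'a \<Rightarrow>\<^sub>0 int) set \<Rightarrow> ('a \<times> 'b \<Rightarrow>\<^sub>0 int) set"
    and \<mu> :: "('b \<times> 'a \<Rightarrow>\<^sub>0 int) set \<Rightarrow> 'a"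
    and \<rho> \<Lambda> :: "'a \<Rightarrow> ('a \<times> 'b \<Rightarrow>\<^sub>0 int) set"
  assumes "assoc_algebra K A" and "assoc_algebra K B"
    and "twisting_map K A B R"
    and "linear_map K (tensor K B A) A \<mu>"
    and "linear_map K A (tensor K A B) \<rho>"
    and "\<rho> \<one>\<^bsub>A\<^esub> = pure_tensor K A B \<one>\<^bsub>A\<^esub> \<one>\<^bsub>B\<^esub>"
    and "\<And>a. a \<in> carrier A \<Longrightarrow> \<mu> (pure_tensor K B A \<one>\<^bsub>B\<^esub> a) = a"
    and "\<And>a. a \<in> carrier A \<Longrightarrow>
           sweedler A (\<rho> a) (\<lambda>a0 a1. a0 \<otimes>\<^bsub>A\<^esub> \<mu> (pure_tensor K B A a1 \<one>\<^bsub>A\<^esub>)) = a"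
    and "\<And>a a' b. a \<in> carrier A \<Longrightarrow> a' \<in> carrier A \<Longrightarrow> b \<in> carrier B \<Longrightarrow>
           \<mu> (pure_tensor K B A b (deformed_mult K A B \<mu> \<rho> a a')) =
           sweedler A (\<rho> a) (\<lambda>a0 a1.
           sweedler A (R (pure_tensor K B A b a0)) (\<lambda>a0R bR.
             a0R \<otimes>\<^bsub>A\<^esub> \<mu> (pure_tensor K B A (bR \<otimes>\<^bsub>B\<^esub> a1) a')))"
    and "\<And>a a'. a \<in> carrier A \<Longrightarrow> a' \<in> carrier A \<Longrightarrow>
           \<rho> (deformed_mult K A B \<mu> \<rho> a a') =
           sweedler (tensor K A B) (\<rho> a) (\<lambda>a0 a1.
           sweedler (tensor K A B) (\<rho> a') (\<lambda>a'0 a'1.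
           sweedler (tensor K A B) (R (pure_tensor K B A a1 a'0)) (\<lambda>a'0R a1R.
             pure_tensor K A B (a0 \<otimes>\<^bsub>A\<^esub> a'0R) (a1R \<otimes>\<^bsub>B\<^esub> a'1))))"
    and "linear_map K A (tensor K A B) \<Lambda>"
    and "\<Lambda> \<one>\<^bsub>A\<^esub> = pure_tensor K A B \<one>\<^bsub>A\<^esub> \<one>\<^bsub>B\<^esub>"
    and "\<And>a a'. a \<in> carrier A \<Longrightarrow> a' \<in> carrier A \<Longrightarrow>
           \<Lambda> (a \<otimes>\<^bsub>A\<^esub> a') =
           sweedler (tensor K A B) (\<Lambda> a) (\<lambda>a0 a1.
           sweedler (tensor K A B) (R (pure_tensor K B A a1 a')) (\<lambda>a'R a1R.
           sweedler (tensor K A B) (\<Lambda> a'R) (\<lambda>c0 c1.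
             pure_tensor K A B (deformed_mult K A B \<mu> \<rho> a0 c0) (c1 \<otimes>\<^bsub>B\<^esub> a1R))))"
    and "\<And>a. a \<in> carrier A \<Longrightarrow>
           sweedler (tensor K A B) (\<rho> a) (\<lambda>a0 a1.
           sweedler (tensor K A B) (\<Lambda> a0) (\<lambda>c0 c1.
             pure_tensor K A B c0 (c1 \<otimes>\<^bsub>B\<^esub> a1))) = pure_tensor K A B a \<one>\<^bsub>B\<^esub>"
    and "\<And>a. a \<in> carrier A \<Longrightarrow>
           sweedler (tensor K A B) (\<Lambda> a) (\<lambda>a0 a1.
           sweedler (tensor K A B) (\<rho> a0) (\<lambda>c0 c1.
             pure_tensor K A B c0 (c1 \<otimes>\<^bsub>B\<^esub> a1))) = pure_tensor K A B a \<one>\<^bsub>B\<^esub>"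
  shows "twisting_map K (deformed_algebra K A B \<mu> \<rho>) B (deformed_twisting K A B R \<rho> \<Lambda>) \<and>
         algebra_iso K
           (twisted_tensor K (deformed_algebra K A B \<mu> \<rho>) B (deformed_twisting K A B R \<rho> \<Lambda>))
           (twisted_tensor K A B R)
           (deformation_map K A B \<rho>)"
proof -
  interpret twist K A B R by (rule twistI) fact
  interpret invertible_deformation K A B R \<mu> \<rho> \<Lambda>
    by unfold_locales (fact assms)+
  show ?thesis using twisting_map_Rd algebra_iso_\<phi> ..
qed

end
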